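(* Let $\{\mathcal G,\Gamma_0,\Gamma_1\}$ be a quasi boundary triple for $T\subset A^*$ with $A_j=T\upharpoonright\ker\Gamma_j$, $j=0,1$, and Weyl function $M$, and assume that $A_1$ is self-adjoint in $\mathcal H$ and that there exists $\eta\in\rho(A_0)\cap\rho(A_1)\cap\mathbb R$. Suppose that $\mathscr G_0=\operatorname{ran}(\Gamma_0\upharpoonright\ker\Gamma_1)$ and $\mathscr G_1=\operatorname{ran}(\Gamma_1\upharpoonright\ker\Gamma_0)$ are dense in $\mathcal G$, and equip $\mathscr G_0$ and $\mathscr G_1$ with norms such that each $\mathscr G_j$ is a reflexive Banach space continuously embedded in $\mathcal G$, $\Gamma_0(A_1-\bar\lambda)^{-1}:\mathcal H\to\mathscr G_0$ is continuous for some (hence all) $\lambda\in\rho(A_1)$, and $\Gamma_1(A_0-\bar\lambda)^{-1}:\mathcal H\to\mathscr G_1$ is continuous for some (hence all) $\lambda\in\rho(A_0)$. If $\vartheta$ is a symmetric operator in $\mathcal G$ such that $$\mathscr G_0\subset\operatorname{dom}\vartheta\quad\text{and}\quad\operatorname{ran}(\vartheta\upharpoonright\mathscr G_0)\subset\mathscr G_1,$$ and one of the following conditions (i)-(iii) holds, (i) $\vartheta$ regarded as an operator from $\mathscr G_0$ to $\mathscr G_1$ is compact, (ii) $\vartheta$ regarded as an operator from $\mathscr G_0$ to $\mathscr G_1$ is relatively compact with respect to $M(\eta)$ regarded as an operator from $\mathscr G_0$ to $\mathscr G_1$, (iii) there exist $c_1>0$ and $c_2\in[0,1)$ such that $$\|\vartheta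 x\|_{\mathscr G_1}\le c_1\|x\|_{\mathscr G_1'}+c_2\|M(\eta)x\|_{\mathscr G_1},\qquad x\in\mathscr G_0,$$ then $A_\vartheta=T\upharpoonright\{f\in\operatorname{dom}T:\Gamma f\in\vartheta\}$ is self-adjoint in $\mathcal H$.
   Context: Inner products are linear in the first and antilinear in the second argument. $\mathcal H$ is a separable Hilbert space, $A$ is a closed, densely defined, symmetric operator in $\mathcal H$ with adjoint $A^*$. Quasi boundary triple: let $T\subset A^*$ be a linear operator in $\mathcal H$ with $\overline T=A^*$. A triple $\{\mathcal G,\Gamma_0,\Gamma_1\}$ is a quasi boundary triple for $T\subset A^*$ if $\mathcal G$ is a Hilbert space and $\Gamma_0,\Gamma_1:\operatorname{dom}T\to\mathcal G$ are linear maps such that (a) $(Tf,g)_{\mathcal H}-(f,Tg)_{\mathcal H}=(\Gamma_1f,\Gamma_0g)_{\mathcal G}-(\Gamma_0f,\Gamma_1g)_{\mathcal G}$ for all $f,g\in\operatorname{dom}T$; (b) $\Gamma=(\Gamma_0,\Gamma_1)^\top:\operatorname{dom}T\to\mathcal G\times\mathcal G$ has dense range; (c) $A_0:=T\upharpoonright\ker\Gamma_0$ is self-adjoint in $\mathcal H$. The condition $\Gamma f\in\vartheta$ refers to the graph of $\vartheta$, i.e. $\Gamma_0f\in\operatorname{dom}\vartheta$ and $\Gamma_1f=\vartheta\Gamma_0f$. For $\lambda\in\rho(A_0)$: $\gamma(\lambda):=(\Gamma_0\upharpoonright\ker(T-\lambda))^{-1}$ and the Weyl function is $M(\lambda):=\Gamma_1\gamma(\lambda)$,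 with domain $\operatorname{ran}\Gamma_0\subset\mathcal G$; $M(\lambda)$ maps $\mathscr G_0$ into $\mathscr G_1$. $\mathscr G_1'$ is the anti-dual of $\mathscr G_1$ (continuous antilinear functionals), $\mathscr G_1\hookrightarrow\mathcal G\hookrightarrow\mathscr G_1'$ via the inner product of $\mathcal G$. A linear operator $\theta$ is relatively compact with respect to a linear operator $\mathfrak M$ (both acting between two Banach spaces) if $\operatorname{dom}\mathfrak M\subset\operatorname{dom}\theta$ and $\theta$ maps sequences in $\operatorname{dom}\mathfrak M$ that are bounded in the graph norm of $\mathfrak M$ into sequences having convergent subsequences. In (ii), following the paper's proof, $\mathscr G_0$ as domain of $\mathfrak M=M(\eta)\upharpoonright\mathscr G_0$ is viewed inside the Banach space $\mathscr G_1'$, so that the graph norm of $\mathfrak M$ is $\|x\|_{\mathscr G_1'}+\|M(\eta)x\|_{\mathscr G_1}$ (since $M(\eta)\upharpoonright\mathscr G_0:\mathscr G_0\to\mathscr G_1$ is an isomorphism, this is equivalent to using $\|x\|_{\mathscr G_0}+\|M(\eta)x\|_{\mathscr G_1}$). *)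

theory Defs
  imports "HOL-Analysis.Analysis"
begin

section \<open>Complex Hilbert spaces\<close>

class complex_vector = real_vector +
  fixes scaleC :: "complex \<Rightarrow> 'a \<Rightarrow> 'a" (infixr "*\<^sub>C" 75)
  assumes scaleC_add_right: "c *\<^sub>C (x + y) = c *\<^sub>C x + c *\<^sub>C y"
    and scaleC_add_left: "(c + d) *\<^sub>C x = c *\<^sub>C x + d *\<^sub>C x"
    and scaleC_scaleC: "c *\<^sub>C d *\<^sub>C x = (c * d) *\<^sub>C x"
    and scaleC_one: "1 *\<^sub>C x = x"
    and scaleR_scaleC: "r *\<^sub>R x = complex_of_real r *\<^sub>C x"

interpretation complex_vector: vector_space "scaleC :: complex \<Rightarrow> 'a \<Rightarrow> 'a::complex_vector"
  by unfold_locales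
    (simp_all add: scaleC_add_right scaleC_add_left scaleC_scaleC scaleC_one)

text \<open>The inner product is linear in the first and antilinear in the second argument. The real
  inner product, and hence norm and topology, are those of the underlying real Hilbert space.\<close>

class complex_hilbert = complex_vector + real_inner + complete_space +
  fixes cinner :: "'a \<Rightarrow> 'a \<Rightarrow> complex"
  assumes cinner_add_left: "cinner (x + y) z = cinner x z + cinner y z"
    and cinner_scaleC_left: "cinner (c *\<^sub>C x) y = c * cinner x y"
    and cinner_commute: "cinner x y = cnj (cinner y x)"
    and inner_eq_Re_cinner: "inner x y = Re (cinner x y)"

lemma cinner_self: "cinner x x = complex_of_real ((norm x)\<^sup>2)"
proof -
  have "Im (cinner x x) = - Im (cinner x x)"
    by (metis cinner_commute cnj.simps(2))
  moreover have "Re (cinner x x) = (norm x)\<^sup>2"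
    by (simp add: power2_norm_eq_inner inner_eq_Re_cinner)
  ultimately show ?thesis
    by (simp add: complex_eq_iff)
qed

instantiation complex :: complex_hilbert
begin

definition "c *\<^sub>C (x::complex) = c * x"
definition "cinner (x::complex) y = x * cnj y"

instance
  by standard
    (simp_all add: scaleC_complex_def cinner_complex_def algebra_simps scaleR_conv_of_real
      inner_complex_def)

end

instantiation prod :: (complex_vector, complex_vector) complex_vector
begin

definition "c *\<^sub>C x = (c *\<^sub>C fst x, c *\<^sub>C snd x)"

instance
  by standard
    (auto simp: scaleC_prod_def prod_eq_iff scaleC_add_right scaleC_add_left scaleC_scaleC
      scaleC_one scaleR_scaleC)

end

definition clinear_on :: "'a::complex_vector set \<Rightarrow> ('a \<Rightarrow> 'b::complex_vector) \<Rightarrow> bool" where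
  "clinear_on V f \<longleftrightarrow>
     (\<forall>x\<in>V. \<forall>y\<in>V. f (x + y) = f x + f y) \<and> (\<forall>c. \<forall>x\<in>V. f (c *\<^sub>C x) = c *\<^sub>C f x)"


section \<open>Unbounded operators\<close>

text \<open>Operators are identified with their graphs, so that the inclusion of operators, the closure,
  the domain, the range, the inverse and the product of operators are \<open>\<subseteq>\<close>, \<^const>\<open>closure\<close>,
  \<^const>\<open>Domain\<close>, \<^const>\<open>Range\<close>, \<^const>\<open>converse\<close> and \<^const>\<open>relcomp\<close>
  (with the operator applied first written on the left).\<close>

definition linear_operator :: "('a::complex_vector \<times> 'b::complex_vector) set \<Rightarrow> bool" where
  "linear_operator S \<longleftrightarrow> complex_vector.subspace S \<and> single_valued S"

definition op_app :: "('a \<times> 'b) set \<Rightarrow> 'a \<Rightarrow> 'b" where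
  "op_app S x = (THE y. (x, y) \<in> S)"

definition graph_on :: "'a set \<Rightarrow> ('a \<Rightarrow> 'b) \<Rightarrow> ('a \<times> 'b) set" where
  "graph_on D f = {(x, f x) | x. x \<in> D}"

definition op_restrict :: "('a \<times> 'b) set \<Rightarrow> 'a set \<Rightarrow> ('a \<times> 'b) set" where
  "op_restrict S D = {(x, y) \<in> S. x \<in> D}"

definition op_shift :: "('a \<times> 'a) set \<Rightarrow> complex \<Rightarrow> ('a::complex_vector \<times> 'a) set" where
  "op_shift S l = {(x, y - l *\<^sub>C x) | x y. (x, y) \<in> S}"

definition densely_defined :: "('a::topological_space \<times> 'b) set \<Rightarrow> bool" where
  "densely_defined S \<longleftrightarrow> closure (Domain S) = UNIV"

text \<open>For a densely defined operator this is (the graph of) the adjoint operator.\<close>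

definition adj :: "('a::complex_hilbert \<times> 'a) set \<Rightarrow> ('a \<times> 'a) set" where
  "adj S = {(g, g'). \<forall>(f, f') \<in> S. cinner f' g = cinner f g'}"

definition symmetric_operator :: "('a::complex_hilbert \<times> 'a) set \<Rightarrow> bool" where
  "symmetric_operator S \<longleftrightarrow> linear_operator S \<and>
     (\<forall>(f, f') \<in> S. \<forall>(g, g') \<in> S. cinner f' g = cinner f g')"

definition self_adjoint :: "('a::complex_hilbert \<times> 'a) set \<Rightarrow> bool" where
  "self_adjoint S \<longleftrightarrow> linear_operator S \<and> densely_defined S \<and> adj S = S"

text \<open>Boundedness, equivalently continuity, of a linear operator with respect to a norm \<open>N\<close> on
  its domain and a norm \<open>N'\<close> on a space containing its range.\<close>

definition bounded_op :: "('a \<Rightarrow> real) \<Rightarrow> ('b \<Rightarrow> real) \<Rightarrow> ('a \<times> 'b) set \<Rightarrow> bool" where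
  "bounded_op N N' S \<longleftrightarrow> (\<exists>K. \<forall>(x, y) \<in> S. N' y \<le> K * N x)"

definition resolvent_set :: "('a::complex_hilbert \<times> 'a) set \<Rightarrow> complex set" where
  "resolvent_set S = {l. single_valued ((op_shift S l)\<inverse>) \<and> Range (op_shift S l) = UNIV \<and>
     bounded_op norm norm ((op_shift S l)\<inverse>)}"


section \<open>Subspaces with their own norm\<close>

text \<open>A pair \<open>V\<close>, \<open>N\<close> stands for the linear subspace \<open>V\<close> equipped with the norm \<open>N\<close>, which
  is in general not the ambient norm; the values of \<open>N\<close> outside \<open>V\<close> are irrelevant.\<close>

definition converges_in :: "'a::complex_vector set \<Rightarrow> ('a \<Rightarrow> real) \<Rightarrow> (nat \<Rightarrow> 'a) \<Rightarrow> bool" where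
  "converges_in V N s \<longleftrightarrow> (\<exists>l\<in>V. (\<lambda>n. N (s n - l)) \<longlonglongrightarrow> 0)"

definition normed_on :: "'a::complex_vector set \<Rightarrow> ('a \<Rightarrow> real) \<Rightarrow> bool" where
  "normed_on V N \<longleftrightarrow> complex_vector.subspace V \<and>
     (\<forall>x\<in>V. 0 \<le> N x) \<and> (\<forall>x\<in>V. N x = 0 \<longleftrightarrow> x = 0) \<and>
     (\<forall>x\<in>V. \<forall>y\<in>V. N (x + y) \<le> N x + N y) \<and>
     (\<forall>c. \<forall>x\<in>V. N (c *\<^sub>C x) = cmod c * N x)"

definition banach_on :: "'a::complex_vector set \<Rightarrow> ('a \<Rightarrow> real) \<Rightarrow> bool" where
  "banach_on V N \<longleftrightarrow> normed_on V N \<and>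
     (\<forall>s. range s \<subseteq> V \<and> (\<forall>e>0. \<exists>k. \<forall>m\<ge>k. \<forall>n\<ge>k. N (s m - s n) < e) \<longrightarrow> converges_in V N s)"

definition functional_norm :: "'a set \<Rightarrow> ('a \<Rightarrow> real) \<Rightarrow> ('a \<Rightarrow> complex) \<Rightarrow> real" where
  "functional_norm V N \<phi> = (SUP x\<in>{x \<in> V. N x \<le> 1}. cmod (\<phi> x))"

text \<open>Functionals vanish outside \<open>V\<close>, so that equal functionals are equal as functions.\<close>

definition dual_on :: "'a::complex_vector set \<Rightarrow> ('a \<Rightarrow> real) \<Rightarrow> ('a \<Rightarrow> complex) set" where
  "dual_on V N = {\<phi>. clinear_on V \<phi> \<and> bounded_op N cmod (graph_on V \<phi>) \<and> (\<forall>x. x \<notin> V \<longrightarrow> \<phi> x = 0)}"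

text \<open>Every bounded linear functional on the dual is the evaluation at a point of \<open>V\<close>.\<close>

definition reflexive_on :: "'a::complex_vector set \<Rightarrow> ('a \<Rightarrow> real) \<Rightarrow> bool" where
  "reflexive_on V N \<longleftrightarrow>
     (\<forall>\<Phi>. (\<forall>\<phi>\<in>dual_on V N. \<forall>\<psi>\<in>dual_on V N. \<Phi> (\<lambda>x. \<phi> x + \<psi> x) = \<Phi> \<phi> + \<Phi> \<psi>) \<and>
          (\<forall>c. \<forall>\<phi>\<in>dual_on V N. \<Phi> (\<lambda>x. c * \<phi> x) = c * \<Phi> \<phi>) \<and>
          bounded_op (functional_norm V N) cmod (graph_on (dual_on V N) \<Phi>) \<longrightarrow>
          (\<exists>x\<in>V. \<forall>\<phi>\<in>dual_on V N. \<Phi> \<phi> = \<phi> x))"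

definition reflexive_banach_embedded :: "'a::complex_hilbert set \<Rightarrow> ('a \<Rightarrow> real) \<Rightarrow> bool" where
  "reflexive_banach_embedded V N \<longleftrightarrow>
     banach_on V N \<and> reflexive_on V N \<and> bounded_op N norm (Id_on V)"

text \<open>The norm in the anti-dual of \<open>V\<close>, \<open>N\<close> of the image of \<open>x\<close> under the embedding given by
  the inner product, i.e. of the antilinear functional \<open>y \<mapsto> cinner x y\<close> on \<open>V\<close>.\<close>

definition antidual_norm :: "'a::complex_hilbert set \<Rightarrow> ('a \<Rightarrow> real) \<Rightarrow> 'a \<Rightarrow> real" where
  "antidual_norm V N x = functional_norm V N (cinner x)"

text \<open>Compactness of an everywhere defined linear operator \<open>S\<close> from \<open>V\<close>, \<open>N\<close> to \<open>W\<close>, \<open>N'\<close>.\<close>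

definition compact_operator ::
  "'a::complex_vector set \<Rightarrow> ('a \<Rightarrow> real) \<Rightarrow> 'b::complex_vector set \<Rightarrow> ('b \<Rightarrow> real) \<Rightarrow>
    ('a \<times> 'b) set \<Rightarrow> bool" where
  "compact_operator V N W N' S \<longleftrightarrow>
     linear_operator S \<and> Domain S = V \<and> Range S \<subseteq> W \<and>
     (\<forall>x. range x \<subseteq> V \<and> (\<exists>K. \<forall>n. N (x n) \<le> K) \<longrightarrow>
          (\<exists>r :: nat \<Rightarrow> nat. strict_mono r \<and> converges_in W N' (\<lambda>n. op_app S (x (r n)))))"

text \<open>\<open>S\<close> is relatively compact with respect to \<open>R\<close>, where \<open>N\<close> is the norm of the space
  containing the domain of \<open>R\<close> and \<open>W\<close>, \<open>N'\<close> is the target space of both operators.\<close>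

definition relatively_compact ::
  "('a \<Rightarrow> real) \<Rightarrow> 'b::complex_vector set \<Rightarrow> ('b \<Rightarrow> real) \<Rightarrow>
    ('a::complex_vector \<times> 'b) set \<Rightarrow> ('a \<times> 'b) set \<Rightarrow> bool" where
  "relatively_compact N W N' S R \<longleftrightarrow>
     linear_operator S \<and> linear_operator R \<and> Range S \<subseteq> W \<and> Range R \<subseteq> W \<and>
     Domain R \<subseteq> Domain S \<and>
     (\<forall>x. range x \<subseteq> Domain R \<and> (\<exists>K. \<forall>n. N (x n) + N' (op_app R (x n)) \<le> K) \<longrightarrow>
          (\<exists>r :: nat \<Rightarrow> nat. strict_mono r \<and> converges_in W N' (\<lambda>n. op_app S (x (r n)))))"


section \<open>Quasi boundary triples\<close>

text \<open>The values of the boundary maps outside the domain of \<open>T\<close> are irrelevant.\<close>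

definition quasi_boundary_triple ::
  "('h::complex_hilbert \<times> 'h) set \<Rightarrow> ('h \<times> 'h) set \<Rightarrow>
    ('h \<Rightarrow> 'g::complex_hilbert) \<Rightarrow> ('h \<Rightarrow> 'g) \<Rightarrow> bool" where
  "quasi_boundary_triple A T \<Gamma>0 \<Gamma>1 \<longleftrightarrow>
     linear_operator T \<and> T \<subseteq> adj A \<and> closure T = adj A \<and>
     clinear_on (Domain T) \<Gamma>0 \<and> clinear_on (Domain T) \<Gamma>1 \<and>
     (\<forall>(f, Tf) \<in> T. \<forall>(g, Tg) \<in> T.
        cinner Tf g - cinner f Tg = cinner (\<Gamma>1 f) (\<Gamma>0 g) - cinner (\<Gamma>0 f) (\<Gamma>1 g)) \<and>
     closure ((\<lambda>f. (\<Gamma>0 f, \<Gamma>1 f)) ` Domain T) = UNIV \<and>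
     self_adjoint (op_restrict T {f. \<Gamma>0 f = 0})"

text \<open>For \<open>l\<close> in the resolvent set of the restriction of \<open>T\<close> to the kernel of \<open>\<Gamma>0\<close> the
  following relations are operators, with domain the range of \<open>\<Gamma>0\<close>.\<close>

definition gamma_field ::
  "('h::complex_hilbert \<times> 'h) set \<Rightarrow> ('h \<Rightarrow> 'g::complex_hilbert) \<Rightarrow> complex \<Rightarrow> ('g \<times> 'h) set" where
  "gamma_field T \<Gamma>0 l = (graph_on {f. (f, l *\<^sub>C f) \<in> T} \<Gamma>0)\<inverse>"

definition weyl_function ::
  "('h::complex_hilbert \<times> 'h) set \<Rightarrow> ('h \<Rightarrow> 'g::complex_hilbert) \<Rightarrow> ('h \<Rightarrow> 'g) \<Rightarrow> complex \<Rightarrow>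
    ('g \<times> 'g) set" where
  "weyl_function T \<Gamma>0 \<Gamma>1 l = gamma_field T \<Gamma>0 l O graph_on (Domain T) \<Gamma>1"

end

theory Submission
  imports Defs
begin

text \<open>
  Write \<open>B\<close> for \<open>\<theta>\<close> restricted to \<open>G0\<close>. The operator in question is symmetric by the Green identity
  and the symmetry of \<open>\<theta>\<close>, so it is self-adjoint as soon as \<open>T - c\<close> maps its domain onto the whole
  space for some non-real \<open>c\<close> and for its conjugate (\<open>self_adjoint_if_ranges\<close>). Take \<open>c\<close> close to
  \<open>\<eta>\<close>; then \<open>A1 - c\<close> is onto, and after subtracting a solution of the problem for \<open>A1\<close> it remains
  to solve \<open>\<Gamma>1 u - B (\<Gamma>0 u) = y\<close> in the kernel of \<open>T - c\<close> for every \<open>y\<close> in \<open>G1\<close>.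

  This is done by the method of continuity along \<open>\<Gamma>1 u - s B (\<Gamma>0 u) = y\<close>, \<open>0 \<le> s \<le> 1\<close>. At \<open>s = 0\<close> the
  problem is solvable because \<open>A1 - c\<close> is onto. What makes the continuation work is a bound of
  \<open>B (\<Gamma>0 u)\<close> by \<open>y\<close> in the norm of \<open>G1\<close> that is uniform in \<open>s\<close> (\<open>uniform_bound_in_kernel\<close>):
  since \<open>s B\<close> is symmetric, the Green identity gives
  \<open>\<bar>Im c\<bar> \<parallel>u\<parallel>\<^sup>2 \<le> \<bar>(\<Gamma>0 u, y)\<bar> \<le> P \<parallel>u\<parallel> N1 y\<close>, which bounds \<open>u\<close>, and with it \<open>\<Gamma>0 u\<close> in the
  anti-dual norm; condition (iii) with \<open>c2 < 1\<close> then bounds \<open>B (\<Gamma>0 u)\<close>, because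
  \<open>M \<eta> (\<Gamma>0 u)\<close> differs from \<open>\<Gamma>1 u = y + s B (\<Gamma>0 u)\<close> only by a term
  that is bounded by a multiple of \<open>\<parallel>u\<parallel>\<close>. This replaces the
  Kato-Rellich theorem, whose smallness condition refers to a Hilbert space norm, while the bound in
  (iii) refers to the given Banach space norm of \<open>G1\<close>.

  The bound of the pairing \<open>(\<Gamma>0 u, y)\<close> and that of \<open>N0 x\<close> by \<open>N1 (M \<eta> x)\<close>, used under (i), rest on
  the open mapping theorem for \<open>\<Gamma>1 (A0 - \<eta>)\<inverse>\<close> as a map onto \<open>G1\<close> (\<open>boundary_lift\<close>).

  Conditions (i) and (ii) imply (iii) with \<open>c2 = 1/2\<close> (\<open>small_relative_bound_if_compact\<close>): a sequence
  violating the bound can be normalised so that \<open>\<theta> x\<^sub>n\<close> has norm 1 and converges in \<open>G1\<close> while \<open>x\<^sub>n\<close>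
  tends to 0 in the anti-dual of \<open>G1\<close>; by symmetry the limit is orthogonal to the dense set \<open>G0\<close>,
  hence 0, which contradicts its having norm 1.
\<close>

section \<open>Banach spaces carried by a subspace\<close>

lemma scaleC_minus_one: "(-1) *\<^sub>C x = - (x::'a::complex_vector)"
  by simp

lemma normed_on_zero: "normed_on V N \<Longrightarrow> 0 \<in> V"
  by (simp add: normed_on_def complex_vector.subspace_0)

lemma normed_on_norm_zero: "normed_on V N \<Longrightarrow> N 0 = 0"
  by (simp add: normed_on_def complex_vector.subspace_0)

lemma normed_on_add: "normed_on V N \<Longrightarrow> x \<in> V \<Longrightarrow> y \<in> V \<Longrightarrow> x + y \<in> V"
  by (simp add: normed_on_def complex_vector.subspace_add)

lemma normed_on_diff: "normed_on V N \<Longrightarrow> x \<in> V \<Longrightarrow> y \<in> V \<Longrightarrow> x - y \<in> V"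
  by (simp add: normed_on_def complex_vector.subspace_diff)

lemma normed_on_scaleC: "normed_on V N \<Longrightarrow> x \<in> V \<Longrightarrow> c *\<^sub>C x \<in> V"
  by (simp add: normed_on_def complex_vector.subspace_scale)

lemma normed_on_scaleR: "normed_on V N \<Longrightarrow> x \<in> V \<Longrightarrow> r *\<^sub>R x \<in> V"
  by (simp add: scaleR_scaleC normed_on_scaleC)

lemma normed_on_nonneg: "normed_on V N \<Longrightarrow> x \<in> V \<Longrightarrow> 0 \<le> N x"
  by (simp add: normed_on_def)

lemma normed_on_eq_zero: "normed_on V N \<Longrightarrow> x \<in> V \<Longrightarrow> N x = 0 \<longleftrightarrow> x = 0"
  by (simp add: normed_on_def)

lemma normed_on_triangle: "normed_on V N \<Longrightarrow> x \<in> V \<Longrightarrow> y \<in> V \<Longrightarrow> N (x + y) \<le> N x + N y"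
  by (simp add: normed_on_def)

lemma normed_on_norm_scaleC: "normed_on V N \<Longrightarrow> x \<in> V \<Longrightarrow> N (c *\<^sub>C x) = cmod c * N x"
  by (simp add: normed_on_def)

lemma normed_on_norm_scaleR: "normed_on V N \<Longrightarrow> x \<in> V \<Longrightarrow> N (r *\<^sub>R x) = \<bar>r\<bar> * N x"
  by (simp add: scaleR_scaleC normed_on_norm_scaleC)

lemma normed_on_minus_commute:
  assumes "normed_on V N" "x \<in> V" "y \<in> V"
  shows "N (x - y) = N (y - x)"
proof -
  have "N (x - y) = N ((-1) *\<^sub>C (y - x))"
    by (simp add: scaleC_minus_one)
  also have "\<dots> = cmod (-1) * N (y - x)"
    by (rule normed_on_norm_scaleC[OF assms(1) normed_on_diff[OF assms(1,3,2)]])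
  also have "\<dots> = N (y - x)"
    by simp
  finally show ?thesis .
qed

lemma normed_on_triangle_diff:
  assumes "normed_on V N" "x \<in> V" "y \<in> V" "z \<in> V"
  shows "N (x - z) \<le> N (x - y) + N (y - z)"
  using normed_on_triangle[OF assms(1) normed_on_diff[OF assms(1-3)] normed_on_diff[OF assms(1,3,4)]]
  by simp

lemma normed_on_triangle_minus:
  assumes "normed_on V N" "x \<in> V" "y \<in> V"
  shows "N (x - y) \<le> N x + N y"
  using normed_on_triangle_diff[OF assms(1,2) normed_on_zero[OF assms(1)] assms(3)]
    normed_on_minus_commute[OF assms(1) normed_on_zero[OF assms(1)] assms(3)] by simp

text \<open>The locale of metric spaces demands symmetry and non-negativity also outside the carrier,
  where \<open>N\<close> is arbitrary; hence the value 0 there.\<close>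

definition norm_dist :: "'a::complex_vector set \<Rightarrow> ('a \<Rightarrow> real) \<Rightarrow> 'a \<Rightarrow> 'a \<Rightarrow> real" where
  "norm_dist V N x y = (if x \<in> V \<and> y \<in> V then N (x - y) else 0)"

lemma Metric_space_norm_dist:
  assumes "normed_on V N"
  shows "Metric_space V (norm_dist V N)"
proof
  fix x y z
  show "0 \<le> norm_dist V N x y"
    by (simp add: norm_dist_def normed_on_diff[OF assms] normed_on_nonneg[OF assms])
  show "norm_dist V N x y = norm_dist V N y x"
    by (simp add: norm_dist_def normed_on_minus_commute[OF assms])
  show "norm_dist V N x y = 0 \<longleftrightarrow> x = y" if "x \<in> V" "y \<in> V"
    using that by (simp add: norm_dist_def normed_on_diff[OF assms] normed_on_eq_zero[OF assms])
  show "norm_dist V N x z \<le> norm_dist V N x y + norm_dist V N y z"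
    if "x \<in> V" "y \<in> V" "z \<in> V"
    using that by (simp add: norm_dist_def normed_on_triangle_diff[OF assms])
qed

lemma mcomplete_norm_dist:
  assumes "banach_on V N"
  shows "Metric_space.mcomplete V (norm_dist V N)"
proof -
  have n: "normed_on V N"
    using assms by (simp add: banach_on_def)
  interpret Metric_space V "norm_dist V N"
    by (rule Metric_space_norm_dist[OF n])
  show ?thesis
    unfolding mcomplete_def
  proof (intro allI impI)
    fix s
    assume c: "MCauchy s"
    then have sV: "range s \<subseteq> V"
      by (simp add: MCauchy_def)
    have "\<exists>k. \<forall>m\<ge>k. \<forall>n\<ge>k. N (s m - s n) < e" if e: "e > 0" for e
    proof -
      obtain k where "\<forall>m n. k \<le> m \<longrightarrow> k \<le> n \<longrightarrow> norm_dist V N (s m) (s n) < e"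
        using c e unfolding MCauchy_def by blast
      then show ?thesis
        using sV by (auto simp: norm_dist_def image_subset_iff)
    qed
    then have "converges_in V N s"
      using assms sV unfolding banach_on_def by blast
    then obtain l where l: "l \<in> V" "(\<lambda>n. N (s n - l)) \<longlonglongrightarrow> 0"
      unfolding converges_in_def by blast
    have "limitin mtopology s l sequentially"
      unfolding limit_metric_sequentially
    proof (intro conjI allI impI l)
      fix e :: real
      assume "e > 0"
      then obtain k where "\<forall>n\<ge>k. norm (N (s n - l) - 0) < e"
        using l(2) unfolding LIMSEQ_iff by blast
      then show "\<exists>k. \<forall>n\<ge>k. s n \<in> V \<and> norm_dist V N (s n) l < e"
        using sV l(1) by (intro exI[of _ k]) (auto simp: norm_dist_def image_subset_iff abs_less_iff)
    qed
    then show "\<exists>x. limitin mtopology s x sequentially"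
      by blast
  qed
qed

text \<open>By Baire's theorem the closure of the image of some ball has interior; differences and dilations
  carry this to every point of \<open>V\<close>, at the price of an error that is half as large as the point.\<close>

lemma open_mapping_approximation:
  fixes Q :: "'a::real_normed_vector \<Rightarrow> 'b::complex_vector"
  assumes V: "banach_on V N"
    and Q: "linear Q" "range Q = V"
  obtains C where "C \<ge> 0" "\<And>z. z \<in> V \<Longrightarrow> \<exists>h. norm h \<le> C * N z \<and> N (z - Q h) \<le> N z / 2"
proof -
  have n: "normed_on V N"
    using V by (simp add: banach_on_def)
  interpret Metric_space V "norm_dist V N"
    by (rule Metric_space_norm_dist[OF n])
  define F where "F k = mtopology closure_of (Q ` {h. norm h \<le> real k})" for k :: nat
  have QV: "Q h \<in> V" for h
    using Q(2) by blast
  have "V \<subseteq> (\<Union>k. F k)"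
  proof
    fix z
    assume "z \<in> V"
    then obtain h where h: "Q h = z"
      using Q(2) by blast
    obtain k where "norm h \<le> real k"
      using real_arch_simple by blast
    then have "z \<in> Q ` {h. norm h \<le> real k}"
      using h by blast
    moreover have "Q ` {h. norm h \<le> real k} \<subseteq> F k"
      unfolding F_def using QV by (intro closure_of_subset) auto
    ultimately show "z \<in> (\<Union>k. F k)"
      by blast
  qed
  moreover have "(\<Union>k. F k) \<subseteq> V"
    unfolding F_def using closure_of_subset_topspace[of mtopology] by auto
  ultimately have U: "(\<Union>k. F k) = topspace mtopology"
    by auto
  have "\<exists>k. mtopology interior_of F k \<noteq> {}"
  proof (rule ccontr)
    assume "\<not> ?thesis"
    then have "mtopology interior_of \<Union>(range F) = {}"
      by (intro metric_Baire_category_alt mcomplete_norm_dist V) (auto simp: F_def)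
    then have "topspace mtopology = {}"
      using U by (metis interior_of_topspace)
    then show False
      using normed_on_zero[OF n] by simp
  qed
  then obtain k z0 where "z0 \<in> mtopology interior_of F k"
    by blast
  then obtain r where z0: "z0 \<in> V" and r: "r > 0" "mball z0 r \<subseteq> F k"
    unfolding metric_interior_of by blast
  have near: "\<exists>h. norm h \<le> real k \<and> N (z - Q h) < e" if "z \<in> F k" "e > 0" "z \<in> V" for z e
  proof -
    have "\<exists>y\<in>Q ` {h. norm h \<le> real k}. y \<in> mball z e"
      using that unfolding F_def metric_closure_of by blast
    then show ?thesis
      using QV that by (auto simp: norm_dist_def)
  qed
  have small: "\<exists>h. norm h \<le> 2 * real k \<and> N (z - Q h) < e" if z: "z \<in> V" "N z < r" and e: "e > 0" for z e
  proof -
    have zz: "z0 + z \<in> V"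
      using normed_on_add[OF n z0 z(1)] .
    have "N (z0 - (z0 + z)) = N ((z0 + z) - z0)"
      by (rule normed_on_minus_commute[OF n z0 zz])
    then have "z0 + z \<in> F k" "z0 \<in> F k"
      using z zz z0 r normed_on_norm_zero[OF n] by (auto simp: norm_dist_def subset_iff)
    then obtain h1 h2 where h: "norm h1 \<le> real k" "norm h2 \<le> real k"
      "N (z0 + z - Q h1) < e/2" "N (z0 - Q h2) < e/2"
      using near[of "z0+z" "e/2"] near[of z0 "e/2"] e zz z0 by auto
    have "z - Q (h1 - h2) = (z0 + z - Q h1) - (z0 - Q h2)"
      by (simp add: linear_diff[OF Q(1)])
    also have "N \<dots> \<le> N (z0 + z - Q h1) + N (z0 - Q h2)"
      by (rule normed_on_triangle_minus[OF n]) (auto intro!: normed_on_diff[OF n] QV zz z0)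
    finally have "N (z - Q (h1 - h2)) < e"
      using h by simp
    moreover have "norm (h1 - h2) \<le> 2 * real k"
      using h norm_triangle_ineq4[of h1 h2] by simp
    ultimately show ?thesis by blast
  qed
  show thesis
  proof
    show "4 * real k / r \<ge> 0"
      using r by simp
    fix z
    assume z: "z \<in> V"
    show "\<exists>h. norm h \<le> 4 * real k / r * N z \<and> N (z - Q h) \<le> N z / 2"
    proof (cases "N z = 0")
      case True
      then show ?thesis
        by (intro exI[of _ 0]) (simp add: linear_0[OF Q(1)])
    next
      case False
      then have Nz: "N z > 0"
        using normed_on_nonneg[OF n z] by simp
      (* The dilation that moves z into the ball of radius r. *)
      define t where "t = r / (2 * N z)"
      have t: "t > 0"
        using Nz r by (simp add: t_def)
      have "t *\<^sub>R z \<in> V" "N (t *\<^sub>R z) = r / 2"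
        using normed_on_scaleR[OF n z] normed_on_norm_scaleR[OF n z, of t] t Nz r
        by (simp_all add: t_def)
      then obtain h where h: "norm h \<le> 2 * real k" "N (t *\<^sub>R z - Q h) < r / 4"
        using small[of "t *\<^sub>R z" "r/4"] r by auto
      have "z - Q (h /\<^sub>R t) = (t *\<^sub>R z - Q h) /\<^sub>R t"
        using t by (simp add: linear_scale[OF Q(1)] scaleR_diff_right)
      then have "N (z - Q (h /\<^sub>R t)) = N (t *\<^sub>R z - Q h) / t"
        using normed_on_norm_scaleR[OF n normed_on_diff[OF n normed_on_scaleR[OF n z] QV], of "inverse t" t h] t
        by (simp add: divide_inverse mult.commute)
      also have "\<dots> \<le> (r / 4) / t"
        using h t by (intro divide_right_mono) auto
      also have "\<dots> = N z / 2"
        using r Nz by (simp add: t_def)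
      finally have "N (z - Q (h /\<^sub>R t)) \<le> N z / 2" .
      moreover have "norm (h /\<^sub>R t) \<le> 2 * real k / t"
        using h(1) t by (simp add: divide_inverse_commute)
      moreover have "2 * real k / t = 4 * real k / r * N z"
        using r Nz by (simp add: t_def)
      ultimately show ?thesis
        by (intro exI[of _ "h /\<^sub>R t"] conjI) linarith+
    qed
  qed
qed

text \<open>Applying the approximation again and again to the error that is left gives a geometric series
  of corrections in the domain, and its sum is an exact preimage.\<close>

lemma open_mapping:
  fixes Q :: "'a::banach \<Rightarrow> 'b::complex_vector"
  assumes V: "banach_on V N"
    and Q: "linear Q" "range Q = V"
    and bd: "\<And>h. N (Q h) \<le> K * norm h"
  obtains C where "C \<ge> 0" "\<And>z. z \<in> V \<Longrightarrow> \<exists>h. Q h = z \<and> norm h \<le> C * N z"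
proof -
  have n: "normed_on V N"
    using V by (simp add: banach_on_def)
  have QV: "Q h \<in> V" for h
    using Q(2) by blast
  obtain C where C: "C \<ge> 0" "\<And>z. z \<in> V \<Longrightarrow> \<exists>h. norm h \<le> C * N z \<and> N (z - Q h) \<le> N z / 2"
    using open_mapping_approximation[OF V Q] by blast
  obtain g where g: "\<And>z. z \<in> V \<Longrightarrow> norm (g z) \<le> C * N z \<and> N (z - Q (g z)) \<le> N z / 2"
    using C(2) by metis
  show thesis
  proof
    show "2 * C \<ge> 0"
      using C by simp
    fix z
    assume z: "z \<in> V"
    define r where "r k = ((\<lambda>y. y - Q (g y)) ^^ k) z" for k
    have rS: "r (Suc k) = r k - Q (g (r k))" and r0: "r 0 = z" for k
      by (simp_all add: r_def)
    have rV: "r k \<in> V" for k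
      by (induction k) (auto simp: rS r0 z intro!: normed_on_diff[OF n] QV)
    have rN: "N (r k) \<le> N z * (1/2)^k" for k
    proof (induction k)
      case (Suc k)
      then show ?case
        using g[OF rV[of k]] by (simp add: rS)
    qed (simp add: r0)
    have bnd: "norm (g (r k)) \<le> C * N z * (1/2)^k" for k
      using g[OF rV[of k]] mult_left_mono[OF rN[of k] C(1)] by (simp add: mult.assoc)
    define s where "s m = (\<Sum>k<m. g (r k))" for m
    have zs: "z - Q (s m) = r m" for m
      by (induction m) (simp_all add: s_def r0 rS linear_0[OF Q(1)] linear_add[OF Q(1)] algebra_simps)
    have summ: "summable (\<lambda>k. C * N z * (1/2)^k)"
      by (intro summable_mult summable_geometric) simp
    have sumn: "summable (\<lambda>k. norm (g (r k)))"
      by (rule summable_comparison_test'[OF summ, of 0]) (use bnd in simp)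
    then have "summable (\<lambda>k. g (r k))"
      by (rule summable_norm_cancel)
    then have s: "s \<longlonglongrightarrow> (\<Sum>k. g (r k))"
      unfolding s_def by (rule summable_LIMSEQ)
    define h where "h = (\<Sum>k. g (r k))"
    have "norm h \<le> (\<Sum>k. norm (g (r k)))"
      unfolding h_def by (rule summable_norm[OF sumn])
    also have "\<dots> \<le> (\<Sum>k. C * N z * (1/2)^k)"
      by (rule suminf_le[OF bnd sumn summ])
    also have "\<dots> = 2 * C * N z"
      by (simp add: suminf_mult suminf_geometric)
    finally have "norm h \<le> 2 * C * N z" .
    moreover have "Q h = z"
    proof -
      have "N (z - Q h) \<le> N z * (1/2)^m + K * norm (s m - h)" for m
      proof -
        have "z - Q h = r m + Q (s m - h)"
          by (simp add: zs[symmetric] linear_diff[OF Q(1)])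
        then have "N (z - Q h) \<le> N (r m) + N (Q (s m - h))"
          using normed_on_triangle[OF n rV QV] by simp
        then show ?thesis
          using rN[of m] bd[of "s m - h"] by simp
      qed
      moreover have "(\<lambda>m. N z * (1/2)^m + K * norm (s m - h)) \<longlonglongrightarrow> N z * 0 + K * 0"
        using s unfolding h_def[symmetric]
        by (intro tendsto_intros LIMSEQ_power_zero) (auto simp: LIM_zero tendsto_norm_zero)
      ultimately have "N (z - Q h) \<le> N z * 0 + K * 0"
        by (intro LIMSEQ_le_const) auto
      then have "N (z - Q h) = 0"
        using normed_on_nonneg[OF n normed_on_diff[OF n z QV]] by (simp add: order_antisym)
      then show ?thesis
        using normed_on_eq_zero[OF n normed_on_diff[OF n z QV]] by simp
    qed
    ultimately show "\<exists>h. Q h = z \<and> norm h \<le> 2 * C * N z"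
      by blast
  qed
qed

section \<open>The method of continuity\<close>

lemma clinear_on_diff:
  assumes "clinear_on X f" "complex_vector.subspace X" "x \<in> X" "y \<in> X"
  shows "f (x - y) = f x - f y"
proof -
  have "f ((x - y) + y) = f (x - y) + f y"
    using assms complex_vector.subspace_diff[OF assms(2-4)] unfolding clinear_on_def by blast
  then show ?thesis
    by simp
qed

text \<open>The equation at \<open>t\<close> is a fixed point equation for the right-hand side that one has to prescribe at
  \<open>s\<close>, and the estimate at \<open>s\<close> makes it a contraction.\<close>

lemma continuity_step:
  assumes V: "banach_on V N"
    and X: "complex_vector.subspace X"
    and ab: "clinear_on X a" "clinear_on X b" "\<And>u. u \<in> X \<Longrightarrow> a u \<in> V" "\<And>u. u \<in> X \<Longrightarrow> b u \<in> V"
    and est: "\<And>u. u \<in> X \<Longrightarrow> N (b u) \<le> C * N (a u - s *\<^sub>R b u)"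
    and onto: "\<And>y. y \<in> V \<Longrightarrow> \<exists>u\<in>X. a u - s *\<^sub>R b u = y"
    and small: "\<bar>t - s\<bar> * C \<le> 1/2"
    and y: "y \<in> V"
  shows "\<exists>u\<in>X. a u - t *\<^sub>R b u = y"
proof -
  have n: "normed_on V N"
    using V by (simp add: banach_on_def)
  interpret Metric_space V "norm_dist V N"
    by (rule Metric_space_norm_dist[OF n])
  obtain R where R: "\<And>y. y \<in> V \<Longrightarrow> R y \<in> X \<and> a (R y) - s *\<^sub>R b (R y) = y"
    using onto by metis
  define F where "F Y = y + (t - s) *\<^sub>R b (R Y)" for Y
  have FV: "F Y \<in> V" if "Y \<in> V" for Y
    unfolding F_def using R[OF that] by (intro normed_on_add[OF n] normed_on_scaleR[OF n] y ab)
      blast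
  have con: "norm_dist V N (F Y) (F Z) \<le> 1/2 * norm_dist V N Y Z" if YZ: "Y \<in> V" "Z \<in> V" for Y Z
  proof -
    define u where "u = R Y - R Z"
    have u: "u \<in> X" "b u = b (R Y) - b (R Z)" "a u = a (R Y) - a (R Z)"
      unfolding u_def using R YZ
      by (auto intro: complex_vector.subspace_diff X clinear_on_diff[OF ab(1) X] clinear_on_diff[OF ab(2) X])
    have "a u - s *\<^sub>R b u = (a (R Y) - s *\<^sub>R b (R Y)) - (a (R Z) - s *\<^sub>R b (R Z))"
      by (simp add: u algebra_simps)
    then have au: "a u - s *\<^sub>R b u = Y - Z"
      using R YZ by simp
    have "F Y - F Z = (t - s) *\<^sub>R b u"
      by (simp add: F_def u algebra_simps)
    then have "N (F Y - F Z) = \<bar>t - s\<bar> * N (b u)"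
      using normed_on_norm_scaleR[OF n ab(4)[OF u(1)]] by simp
    also have "\<dots> \<le> \<bar>t - s\<bar> * (C * N (Y - Z))"
      using est[OF u(1)] by (intro mult_left_mono) (auto simp: au)
    also have "\<dots> = (\<bar>t - s\<bar> * C) * N (Y - Z)"
      by simp
    also have "\<dots> \<le> 1/2 * N (Y - Z)"
      by (intro mult_right_mono small normed_on_nonneg[OF n] normed_on_diff[OF n] YZ)
    finally show ?thesis
      using FV YZ by (simp add: norm_dist_def)
  qed
  obtain Y where Y: "Y \<in> V" "F Y = Y"
    using Banach_fixedpoint_thm[OF mcomplete_norm_dist[OF V], of F "1/2"] FV con y by auto
  have "a (R Y) - t *\<^sub>R b (R Y) = (a (R Y) - s *\<^sub>R b (R Y)) - (t - s) *\<^sub>R b (R Y)"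
    by (simp add: algebra_simps)
  also have "\<dots> = F Y - (t - s) *\<^sub>R b (R Y)"
    using R[OF Y(1)] Y(2) by simp
  also have "\<dots> = y"
    by (simp add: F_def)
  finally show ?thesis
    using R[OF Y(1)] by blast
qed

text \<open>The length of the steps allowed by \<open>continuity_step\<close> depends only on \<open>C\<close>, so finitely many of
  them lead from 0 to 1. The solvability of the unperturbed problem is inherited although no bound
  relates \<open>b\<close> to \<open>a\<close> with a constant below 1.\<close>

lemma continuity_method:
  assumes V: "banach_on V N"
    and X: "complex_vector.subspace X"
    and ab: "clinear_on X a" "clinear_on X b" "\<And>u. u \<in> X \<Longrightarrow> a u \<in> V" "\<And>u. u \<in> X \<Longrightarrow> b u \<in> V"
    and est: "\<And>s u. 0 \<le> s \<Longrightarrow> s \<le> 1 \<Longrightarrow> u \<in> X \<Longrightarrow> N (b u) \<le> C * N (a u - s *\<^sub>R b u)"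
    and onto: "\<And>y. y \<in> V \<Longrightarrow> \<exists>u\<in>X. a u = y"
    and y: "y \<in> V"
  shows "\<exists>u\<in>X. a u - b u = y"
proof -
  obtain n :: nat where n: "2 * \<bar>C\<bar> + 1 \<le> real n"
    using real_arch_simple by blast
  then have n0: "real n > 0"
    by linarith
  have "k \<le> n \<Longrightarrow> \<forall>y\<in>V. \<exists>u\<in>X. a u - (real k / real n) *\<^sub>R b u = y" for k
  proof (induction k)
    case 0
    then show ?case
      using onto by simp
  next
    case (Suc k)
    show ?case
    proof
      fix y
      assume y: "y \<in> V"
      show "\<exists>u\<in>X. a u - (real (Suc k) / real n) *\<^sub>R b u = y"
      proof (rule continuity_step[OF V X ab _ _ _ y, where C = C and s = "real k / real n"])
        show "N (b u) \<le> C * N (a u - (real k / real n) *\<^sub>R b u)" if "u \<in> X" for u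
          using that Suc.prems n0 by (intro est) auto
        show "\<exists>u\<in>X. a u - (real k / real n) *\<^sub>R b u = y" if "y \<in> V" for y
          using Suc that by auto
        have "\<bar>real (Suc k) / real n - real k / real n\<bar> * C = C / real n"
          using n0 by (simp add: field_simps)
        also have "\<dots> \<le> 1/2"
          using n n0 by (simp add: field_simps)
        finally show "\<bar>real (Suc k) / real n - real k / real n\<bar> * C \<le> 1/2" .
      qed
    qed
  qed
  from this[of n] show ?thesis
    using n0 y by simp
qed

section \<open>Symmetric operators in a complex Hilbert space\<close>

instance complex_hilbert \<subseteq> banach
  by standard

lemma cinner_add_right: "cinner x (y + z) = cinner x y + cinner x z"
  by (metis cinner_add_left cinner_commute complex_cnj_add)

lemma cinner_scaleC_right: "cinner x (c *\<^sub>C y) = cnj c * cinner x y"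
  by (metis cinner_commute cinner_scaleC_left complex_cnj_mult)

lemma cinner_minus_left: "cinner (- x) y = - cinner x y"
  using cinner_scaleC_left[of "-1" x y] by (simp del: complex_vector.scale_minus_left add: scaleC_minus_one)

lemma cinner_minus_right: "cinner x (- y) = - cinner x y"
  by (metis cinner_commute cinner_minus_left complex_cnj_minus)

lemma cinner_diff_left: "cinner (x - y) z = cinner x z - cinner y z"
  using cinner_add_left[of x "- y" z] by (simp add: cinner_minus_left)

lemma cinner_diff_right: "cinner x (y - z) = cinner x y - cinner x z"
  using cinner_add_right[of x y "- z"] by (simp add: cinner_minus_right)

lemma cinner_zero_left: "cinner 0 x = 0"
  using cinner_diff_left[of 0 0 x] by simp

lemma cinner_zero_right: "cinner x 0 = 0"
  using cinner_diff_right[of x 0 0] by simp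

lemmas cinner_simps = cinner_add_left cinner_add_right cinner_diff_left cinner_diff_right
  cinner_scaleC_left cinner_scaleC_right cinner_zero_left cinner_zero_right

lemma norm_scaleC: "norm (c *\<^sub>C (x::'a::complex_hilbert)) = cmod c * norm x"
proof -
  have "complex_of_real ((norm (c *\<^sub>C x))\<^sup>2) = c * cnj c * complex_of_real ((norm x)\<^sup>2)"
    unfolding cinner_self[symmetric] by (simp add: cinner_simps)
  also have "\<dots> = complex_of_real ((cmod c * norm x)\<^sup>2)"
    by (simp only: complex_norm_square[symmetric] of_real_mult power_mult_distrib of_real_power)
  finally have "(norm (c *\<^sub>C x))\<^sup>2 = (cmod c * norm x)\<^sup>2"
    using of_real_eq_iff by blast
  then show ?thesis
    by (simp add: power2_eq_iff_nonneg)
qed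

lemma cmod_cinner_le: "cmod (cinner x y) \<le> norm x * norm (y::'a::complex_hilbert)"
proof (cases "cinner x y = 0")
  case False
  (* A phase that makes the inner product real, so that the real Cauchy-Schwarz inequality applies. *)
  define w where "w = cnj (cinner x y) / complex_of_real (cmod (cinner x y))"
  have w: "cmod w = 1"
    using False by (simp add: w_def norm_divide)
  have "cinner (w *\<^sub>C x) y = complex_of_real (cmod (cinner x y))"
    using False complex_norm_square[of "cinner x y"]
    by (simp add: cinner_simps w_def field_simps power2_eq_square)
  then have "cmod (cinner x y) = inner (w *\<^sub>C x) y"
    by (simp add: inner_eq_Re_cinner)
  also have "\<dots> \<le> norm (w *\<^sub>C x) * norm y"
    by (rule norm_cauchy_schwarz)
  finally show ?thesis
    using w by (simp add: norm_scaleC)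
qed simp

lemma cinner_eq_zero_if_inner_eq_zero:
  assumes "inner x y = 0" "inner (\<i> *\<^sub>C x) y = 0"
  shows "cinner x (y::'a::complex_hilbert) = 0"
  using assms by (simp add: inner_eq_Re_cinner cinner_simps complex_eq_iff)

text \<open>Completeness takes the place of compactness: a minimising sequence is a Cauchy sequence by the
  parallelogram law, because the midpoints are not closer to \<open>x\<close> than the infimum.\<close>

lemma infdist_attained_in_closure:
  fixes D :: "'a::{real_inner, complete_space} set"
  assumes D: "subspace D"
  obtains y where "y \<in> closure D" "\<And>z. z \<in> D \<Longrightarrow> norm (x - y) \<le> norm (x - z)"
proof -
  define d where "d = infdist x D"
  have ne: "D \<noteq> {}"
    using subspace_0[OF D] by blast
  have d: "d \<le> norm (x - z)" if "z \<in> D" for z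
    using infdist_le[OF that, of x] by (simp add: d_def dist_norm)
  have d0: "d \<ge> 0"
    by (simp add: d_def infdist_nonneg)
  have "\<exists>z\<in>D. (norm (x - z))\<^sup>2 < d\<^sup>2 + inverse (real (Suc n))" for n
  proof -
    have "d < sqrt (d\<^sup>2 + inverse (real (Suc n)))"
      by (rule real_less_rsqrt) simp
    then obtain z where "z \<in> D" "dist x z < sqrt (d\<^sup>2 + inverse (real (Suc n)))"
      using ne unfolding d_def infdist_def by (auto simp: cInf_less_iff)
    moreover from this have "(dist x z)\<^sup>2 < (sqrt (d\<^sup>2 + inverse (real (Suc n))))\<^sup>2"
      by (intro power_strict_mono) auto
    ultimately show ?thesis
      by (intro bexI[of _ z]) (simp_all add: dist_norm add_nonneg_nonneg)
  qed
  then obtain s where s: "\<And>n. s n \<in> D" "\<And>n. (norm (x - s n))\<^sup>2 < d\<^sup>2 + inverse (real (Suc n))"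
    by metis
  have par: "(norm (s m - s n))\<^sup>2 \<le> 2 * inverse (real (Suc m)) + 2 * inverse (real (Suc n))" for m n
  proof -
    have "(1/2) *\<^sub>R (s m + s n) \<in> D"
      by (intro subspace_scale subspace_add D s)
    then have "d\<^sup>2 \<le> (norm (x - (1/2) *\<^sub>R (s m + s n)))\<^sup>2"
      using d d0 by (intro power_mono) auto
    moreover have "(norm (s m - s n))\<^sup>2 + 4 * (norm (x - (1/2) *\<^sub>R (s m + s n)))\<^sup>2
        = 2 * (norm (x - s m))\<^sup>2 + 2 * (norm (x - s n))\<^sup>2"
      by (simp add: power2_norm_eq_inner inner_simps inner_commute algebra_simps)
    ultimately show ?thesis
      using s(2)[of m] s(2)[of n] by linarith
  qed
  have "Cauchy s"
  proof (rule CauchyI)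
    fix e :: real
    assume e: "e > 0"
    then obtain k where k: "inverse (real (Suc k)) < e\<^sup>2 / 4"
      using reals_Archimedean[of "e\<^sup>2 / 4"] by auto
    have "norm (s m - s n) < e" if "m \<ge> k" "n \<ge> k" for m n
    proof -
      have "inverse (real (Suc m)) \<le> inverse (real (Suc k))" "inverse (real (Suc n)) \<le> inverse (real (Suc k))"
        using that by (auto intro!: le_imp_inverse_le)
      then have "(norm (s m - s n))\<^sup>2 < e\<^sup>2"
        using par[of m n] k by linarith
      then show ?thesis
        using e by (simp add: power2_less_imp_less)
    qed
    then show "\<exists>M. \<forall>m\<ge>M. \<forall>n\<ge>M. norm (s m - s n) < e"
      by blast
  qed
  then obtain y where y: "s \<longlonglongrightarrow> y"
    using Cauchy_convergent convergent_def by blast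
  show thesis
  proof
    show "y \<in> closure D"
      using y s(1) closure_sequential by blast
    have "(\<lambda>n. (norm (x - s n))\<^sup>2) \<longlonglongrightarrow> (norm (x - y))\<^sup>2"
      by (intro tendsto_intros y)
    moreover have "(\<lambda>n. d\<^sup>2 + inverse (real (Suc n))) \<longlonglongrightarrow> d\<^sup>2 + 0"
      by (intro tendsto_intros LIMSEQ_inverse_real_of_nat)
    ultimately have "(norm (x - y))\<^sup>2 \<le> d\<^sup>2 + 0"
      by (rule LIMSEQ_le) (use s(2) less_imp_le in blast)
    then have "norm (x - y) \<le> d"
      by (intro power2_le_imp_le[OF _ d0]) simp
    then show "norm (x - y) \<le> norm (x - z)" if "z \<in> D" for z
      using d[OF that] by simp
  qed
qed

lemma closure_eq_UNIV_if_orthogonal_trivial: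
  fixes D :: "'a::{real_inner, complete_space} set"
  assumes D: "subspace D"
    and orth: "\<And>g. (\<And>z. z \<in> D \<Longrightarrow> inner z g = 0) \<Longrightarrow> g = 0"
  shows "closure D = UNIV"
proof (intro set_eqI iffI UNIV_I)
  fix x :: 'a
  obtain y where y: "y \<in> closure D" "\<And>z. z \<in> D \<Longrightarrow> norm (x - y) \<le> norm (x - z)"
    using infdist_attained_in_closure[OF D] by blast
  have y': "norm (x - y) \<le> norm (x - (y + z))" if z: "z \<in> D" for z
  proof -
    obtain s where s: "\<And>n. s n \<in> D" "s \<longlonglongrightarrow> y"
      using y(1) closure_sequential by blast
    have "norm (x - y) \<le> norm (x - (s n + z))" for n
      by (intro y(2) subspace_add D s z)
    moreover have "(\<lambda>n. norm (x - (s n + z))) \<longlonglongrightarrow> norm (x - (y + z))"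
      by (intro tendsto_intros s)
    ultimately show ?thesis
      by (intro LIMSEQ_le_const) auto
  qed
  have "x - y = 0"
  proof (rule orth)
    fix z
    assume z: "z \<in> D"
    define g where "g = x - y"
    show "inner z (x - y) = 0"
    proof (cases "z = 0")
      case False
      (* t z is the projection of x - y onto the line through z; adding it to y cannot bring y closer
         to x. *)
      define t where "t = inner z g / (norm z)\<^sup>2"
      have nz: "(norm z)\<^sup>2 > 0"
        using False by simp
      from y'[OF subspace_scale[OF D z], of t] have "norm g \<le> norm (g - t *\<^sub>R z)"
        by (simp add: g_def algebra_simps)
      then have "(norm g)\<^sup>2 \<le> (norm (g - t *\<^sub>R z))\<^sup>2"
        by (intro power_mono) auto
      also have "\<dots> = (norm g)\<^sup>2 - 2 * t * inner z g + t\<^sup>2 * (norm z)\<^sup>2"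
        unfolding power2_norm_eq_inner
        by (simp add: inner_simps inner_commute power2_eq_square algebra_simps)
      also have "t\<^sup>2 * (norm z)\<^sup>2 = t * inner z g"
        using nz by (simp add: t_def power2_eq_square)
      finally have "t * inner z g \<le> 0"
        by simp
      then have "(inner z g)\<^sup>2 / (norm z)\<^sup>2 \<le> 0"
        by (simp add: t_def power2_eq_square)
      then have "(inner z g)\<^sup>2 \<le> 0"
        using nz by (simp add: divide_le_0_iff)
      then show ?thesis
        by (simp add: g_def)
    qed simp
  qed
  then show "x \<in> closure D"
    using y(1) by simp
qed

lemma linear_operator_add:
  "linear_operator S \<Longrightarrow> (f, f') \<in> S \<Longrightarrow> (g, g') \<in> S \<Longrightarrow> (f + g, f' + g') \<in> S"
  using complex_vector.subspace_add[of S "(f, f')" "(g, g')"] by (simp add: linear_operator_def)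

lemma linear_operator_diff:
  "linear_operator S \<Longrightarrow> (f, f') \<in> S \<Longrightarrow> (g, g') \<in> S \<Longrightarrow> (f - g, f' - g') \<in> S"
  using complex_vector.subspace_diff[of S "(f, f')" "(g, g')"] by (simp add: linear_operator_def)

lemma linear_operator_scaleC:
  "linear_operator S \<Longrightarrow> (f, f') \<in> S \<Longrightarrow> (c *\<^sub>C f, c *\<^sub>C f') \<in> S"
  using complex_vector.subspace_scale[of S "(f, f')" c]
  by (simp add: linear_operator_def scaleC_prod_def)

lemma linear_operator_zero: "linear_operator S \<Longrightarrow> (0, 0) \<in> S"
  using complex_vector.subspace_0[of S] by (simp add: linear_operator_def zero_prod_def)

lemma linear_operator_unique:
  "linear_operator S \<Longrightarrow> (f, f') \<in> S \<Longrightarrow> (f, f'') \<in> S \<Longrightarrow> f' = f''"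
  by (auto simp: linear_operator_def single_valued_def)

lemma op_shift_iff: "(f, h) \<in> op_shift S c \<longleftrightarrow> (f, h + c *\<^sub>C f) \<in> S"
proof
  assume "(f, h) \<in> op_shift S c"
  then show "(f, h + c *\<^sub>C f) \<in> S"
    by (auto simp: op_shift_def)
next
  assume "(f, h + c *\<^sub>C f) \<in> S"
  moreover have "h = (h + c *\<^sub>C f) - c *\<^sub>C f"
    by simp
  ultimately show "(f, h) \<in> op_shift S c"
    unfolding op_shift_def by blast
qed

lemma op_app_eq: "linear_operator S \<Longrightarrow> (f, f') \<in> S \<Longrightarrow> op_app S f = f'"
  unfolding op_app_def by (rule the_equality) (auto dest: linear_operator_unique)

lemma symmetric_self_eq_zero:
  assumes S: "symmetric_operator S" and f: "(f, f') \<in> S" and c: "Im c \<noteq> 0"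
    and zero: "cinner (f' - c *\<^sub>C f) f = 0"
  shows "f = 0"
proof -
  have "cinner f' f = cinner f f'"
    using S f by (auto simp: symmetric_operator_def)
  also have "\<dots> = cnj (cinner f' f)"
    by (rule cinner_commute)
  finally have "Im (cinner f' f) = 0"
    by (simp add: complex_eq_iff)
  moreover have "cinner f' f = c * complex_of_real ((norm f)\<^sup>2)"
    using zero by (simp add: cinner_simps cinner_self)
  ultimately have "Im c * (norm f)\<^sup>2 = 0"
    by simp
  then show ?thesis
    using c by simp
qed

text \<open>A vector orthogonal to the domain is of the form \<open>(S - c) f\<close>, and pairing it with \<open>f\<close> shows \<open>f = 0\<close>;
  this gives the density. For \<open>(g, g')\<close> in the adjoint, solve \<open>(S - c) f = g' - c g\<close>; then \<open>g - f\<close> is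
  orthogonal to the range of \<open>S - cnj c\<close>, hence 0.\<close>

lemma self_adjoint_if_ranges:
  assumes S: "symmetric_operator S" and c: "Im c \<noteq> 0"
    and r1: "Range (op_shift S c) = UNIV" and r2: "Range (op_shift S (cnj c)) = UNIV"
  shows "self_adjoint S"
  unfolding self_adjoint_def
proof (intro conjI)
  show lin: "linear_operator S"
    using S by (simp add: symmetric_operator_def)
  show "densely_defined S"
    unfolding densely_defined_def
  proof (rule closure_eq_UNIV_if_orthogonal_trivial)
    have scale: "d *\<^sub>C x \<in> Domain S" if "x \<in> Domain S" for d x
      using that linear_operator_scaleC[OF lin] by blast
    show "subspace (Domain S)"
      unfolding subspace_def scaleR_scaleC
      using linear_operator_zero[OF lin] linear_operator_add[OF lin] scale by blast
    fix g
    assume g: "inner z g = 0" if "z \<in> Domain S" for z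
    have orth: "cinner z g = 0" if "z \<in> Domain S" for z
      by (intro cinner_eq_zero_if_inner_eq_zero g scale that)
    obtain f where f: "(f, g) \<in> op_shift S c"
      using r1 by blast
    then have fS: "(f, g + c *\<^sub>C f) \<in> S"
      by (simp add: op_shift_iff)
    then have "cinner f g = 0"
      using orth by blast
    then have "cinner g f = 0"
      by (metis cinner_commute complex_cnj_zero)
    then have "f = 0"
      using symmetric_self_eq_zero[OF S fS c] by simp
    then show "g = 0"
      using fS linear_operator_unique[OF lin linear_operator_zero[OF lin]] by fastforce
  qed
  show "adj S = S"
  proof (intro set_eqI iffI)
    fix p
    assume "p \<in> S"
    then show "p \<in> adj S"
      using S by (fastforce simp: symmetric_operator_def adj_def)
  next
    fix p
    assume p: "p \<in> adj S"
    obtain g g' where gp: "p = (g, g')"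
      by (cases p)
    have g: "cinner k' g = cinner k g'" if "(k, k') \<in> S" for k k'
      using p that by (auto simp: adj_def gp)
    obtain f where "(f, g' - c *\<^sub>C g) \<in> op_shift S c"
      using r1 by blast
    then have f: "(f, g' - c *\<^sub>C g + c *\<^sub>C f) \<in> S"
      by (simp add: op_shift_iff)
    obtain k where "(k, g - f) \<in> op_shift S (cnj c)"
      using r2 by blast
    then have k: "(k, g - f + cnj c *\<^sub>C k) \<in> S"
      by (simp add: op_shift_iff)
    have "cinner (g - f + cnj c *\<^sub>C k) f = cinner k (g' - c *\<^sub>C g + c *\<^sub>C f)"
      using S k f unfolding symmetric_operator_def by blast
    moreover have "cinner (g - f + cnj c *\<^sub>C k) g = cinner k g'"
      by (rule g[OF k])
    ultimately have "cinner (g - f) (g - f) = 0"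
      by (simp add: cinner_simps) algebra
    then have "g = f"
      by (simp add: cinner_self)
    then show "p \<in> S"
      using f by (simp add: gp)
  qed
qed

section \<open>Resolvents\<close>

lemma resolventE:
  assumes S: "linear_operator S" and c: "c \<in> resolvent_set S"
  obtains R K where "K \<ge> 0" "clinear_on UNIV R" "\<And>h. (R h, h + c *\<^sub>C R h) \<in> S"
    "\<And>h. norm (R h) \<le> K * norm h" "\<And>f f'. (f, f') \<in> S \<Longrightarrow> R (f' - c *\<^sub>C f) = f"
proof -
  have "\<exists>f. (f, h) \<in> op_shift S c" for h
    using c by (auto simp: resolvent_set_def)
  then obtain R where R: "\<And>h. (R h, h) \<in> op_shift S c"
    by metis
  have sv: "f = g" if "(f, h) \<in> op_shift S c" "(g, h) \<in> op_shift S c" for f g h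
    using c that by (auto simp: resolvent_set_def single_valued_def)
  obtain K where K: "\<And>f h. (f, h) \<in> op_shift S c \<Longrightarrow> norm f \<le> K * norm h"
    using c by (fastforce simp: resolvent_set_def bounded_op_def)
  have RS: "(R h, h + c *\<^sub>C R h) \<in> S" for h
    using R[of h] by (simp add: op_shift_iff)
  show thesis
  proof
    show "\<bar>K\<bar> \<ge> 0"
      by simp
    show "(R h, h + c *\<^sub>C R h) \<in> S" for h
      by (rule RS)
    show "norm (R h) \<le> \<bar>K\<bar> * norm h" for h
      using K[OF R[of h]] mult_right_mono[OF abs_ge_self, of "norm h" K] by simp
    show "R (f' - c *\<^sub>C f) = f" if "(f, f') \<in> S" for f f'
      using that by (intro sv[OF R]) (simp add: op_shift_iff)
    show "clinear_on UNIV R"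
      unfolding clinear_on_def
    proof (intro conjI allI ballI)
      fix g h d
      have "(R g + R h, (g + c *\<^sub>C R g) + (h + c *\<^sub>C R h)) \<in> S"
        by (rule linear_operator_add[OF S RS RS])
      then show "R (g + h) = R g + R h"
        by (intro sv[OF R]) (simp add: op_shift_iff algebra_simps scaleC_add_right)
      have "(d *\<^sub>C R h, d *\<^sub>C (h + c *\<^sub>C R h)) \<in> S"
        by (rule linear_operator_scaleC[OF S RS])
      then show "R (d *\<^sub>C h) = d *\<^sub>C R h"
        by (intro sv[OF R]) (simp add: op_shift_iff scaleC_add_right scaleC_scaleC mult.commute)
    qed
  qed
qed

text \<open>The Neumann series, in the form of a fixed point of \<open>f \<mapsto> (S - c)\<inverse> (h + (d - c) f)\<close>.\<close>

lemma range_shift_near_resolvent_set: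
  fixes S :: "('a::complex_hilbert \<times> 'a) set"
  assumes S: "linear_operator S" and c: "c \<in> resolvent_set S"
  obtains e where "e > 0" "\<And>d. cmod (d - c) < e \<Longrightarrow> Range (op_shift S d) = UNIV"
proof -
  obtain R K where K: "K \<ge> 0" and R: "clinear_on UNIV R" "\<And>h. (R h, h + c *\<^sub>C R h) \<in> S"
    "\<And>h. norm (R h) \<le> K * norm h"
    using resolventE[OF S c] by metis
  show thesis
  proof
    show "1 / (2 * (K + 1)) > 0"
      using K by simp
    fix d
    assume d: "cmod (d - c) < 1 / (2 * (K + 1))"
    then have dK: "K * cmod (d - c) \<le> 1/2"
    proof -
      have "K * cmod (d - c) \<le> (K + 1) * (1 / (2 * (K + 1)))"
        using d K by (intro mult_mono) auto
      also have "\<dots> = 1/2"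
        using K by simp
      finally show ?thesis .
    qed
    have "h \<in> Range (op_shift S d)" for h
    proof -
      define F where "F f = R (h + (d - c) *\<^sub>C f)" for f
      have "dist (F f) (F g) \<le> 1/2 * dist f g" for f g
      proof -
        have "F f - F g = R ((d - c) *\<^sub>C (f - g))"
          unfolding F_def
          using clinear_on_diff[OF R(1), of "h + (d - c) *\<^sub>C f" "h + (d - c) *\<^sub>C g"]
          by (simp add: complex_vector.scale_right_diff_distrib)
        then have "norm (F f - F g) \<le> K * (cmod (d - c) * norm (f - g))"
          using R(3)[of "(d - c) *\<^sub>C (f - g)"] by (simp only: norm_scaleC)
        also have "\<dots> = K * cmod (d - c) * norm (f - g)"
          by simp
        also have "\<dots> \<le> 1/2 * norm (f - g)"
          by (intro mult_right_mono dK) simp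
        finally show ?thesis
          by (simp add: dist_norm)
      qed
      then obtain f where "F f = f"
        using banach_fix_type[of "1/2" F] by auto
      then have "(f, h + (d - c) *\<^sub>C f + c *\<^sub>C f) \<in> S"
        using R(2)[of "h + (d - c) *\<^sub>C f"] by (simp add: F_def)
      then have "(f, h + d *\<^sub>C f) \<in> S"
        by (simp add: complex_vector.scale_left_diff_distrib)
      then show ?thesis
        by (auto simp: op_shift_iff Range_iff)
    qed
    then show "Range (op_shift S d) = UNIV"
      by blast
  qed
qed

section \<open>Compactness implies a small relative bound\<close>

lemma embedded_obtain:
  assumes "reflexive_banach_embedded V N"
  obtains K where "K \<ge> 0" "\<And>z. z \<in> V \<Longrightarrow> norm z \<le> K * N z"
proof -
  obtain K where K: "\<And>z. z \<in> V \<Longrightarrow> norm z \<le> K * N z"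
    using assms by (auto simp: reflexive_banach_embedded_def bounded_op_def)
  have n: "normed_on V N"
    using assms by (simp add: reflexive_banach_embedded_def banach_on_def)
  have "norm z \<le> \<bar>K\<bar> * N z" if "z \<in> V" for z
    using K[OF that] mult_right_mono[OF abs_ge_self normed_on_nonneg[OF n that], of K] by simp
  then show thesis
    using that[of "\<bar>K\<bar>"] by simp
qed

lemma antidual_norm_le:
  assumes n: "normed_on V N" and C: "C \<ge> 0"
    and le: "\<And>z. z \<in> V \<Longrightarrow> cmod (cinner x z) \<le> C * N z"
  shows "antidual_norm V N x \<le> C"
  unfolding antidual_norm_def functional_norm_def
proof (rule cSUP_least)
  have "0 \<in> {z \<in> V. N z \<le> 1}"
    using normed_on_zero[OF n] normed_on_norm_zero[OF n] by simp
  then show "{z \<in> V. N z \<le> 1} \<noteq> {}"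
    by blast
  fix z
  assume z: "z \<in> {z \<in> V. N z \<le> 1}"
  then have "cmod (cinner x z) \<le> C * N z"
    using le by simp
  also have "\<dots> \<le> C * 1"
    using z C by (intro mult_left_mono) auto
  finally show "cmod (cinner x z) \<le> C"
    by simp
qed

context
  fixes V :: "'g::complex_hilbert set" and N :: "'g \<Rightarrow> real"
  assumes V: "reflexive_banach_embedded V N"
begin

lemma normed_on_if_embedded: "normed_on V N"
  using V by (simp add: reflexive_banach_embedded_def banach_on_def)

text \<open>A supremum of reals says something only for a bounded set; here the continuity of the embedding
  of \<open>V\<close> supplies the bound.\<close>

lemma cmod_cinner_le_antidual_norm:
  assumes z: "z \<in> V"
  shows "cmod (cinner x z) \<le> antidual_norm V N x * N z"
proof (cases "z = 0")
  case True
  then show ?thesis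
    using normed_on_norm_zero[OF normed_on_if_embedded] by (simp add: cinner_simps)
next
  case False
  note n = normed_on_if_embedded
  obtain K where K: "K \<ge> 0" "\<And>z. z \<in> V \<Longrightarrow> norm z \<le> K * N z"
    using embedded_obtain[OF V] by blast
  have Nz: "N z > 0"
    using normed_on_nonneg[OF n z] normed_on_eq_zero[OF n z] False by linarith
  have bdd: "bdd_above ((\<lambda>z. cmod (cinner x z)) ` {z \<in> V. N z \<le> 1})"
  proof (rule bdd_aboveI2)
    fix z
    assume z: "z \<in> {z \<in> V. N z \<le> 1}"
    have "cmod (cinner x z) \<le> norm x * norm z"
      by (rule cmod_cinner_le)
    also have "norm z \<le> K * N z"
      using K z by simp
    also have "K * N z \<le> K * 1"
      using z K(1) by (intro mult_left_mono) auto
    finally show "cmod (cinner x z) \<le> norm x * (K * 1)"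
      by (simp add: mult_left_mono)
  qed
  define w where "w = (1 / N z) *\<^sub>R z"
  have w: "w \<in> V" "N w = 1"
    using normed_on_scaleR[OF n z] normed_on_norm_scaleR[OF n z, of "1 / N z"] Nz
    by (simp_all add: w_def)
  have "cmod (cinner x w) \<le> antidual_norm V N x"
    unfolding antidual_norm_def functional_norm_def
    by (rule cSUP_upper[OF _ bdd]) (use w in simp)
  moreover have "cmod (cinner x w) = cmod (cinner x z) / N z"
    using Nz by (simp add: w_def scaleR_scaleC cinner_simps norm_mult norm_divide)
  ultimately show ?thesis
    using Nz by (simp add: field_simps)
qed

lemma antidual_norm_nonneg: "antidual_norm V N x \<ge> 0"
proof -
  have n: "normed_on V N"
    by (rule normed_on_if_embedded)
  show ?thesis
  proof (cases "\<exists>z\<in>V. z \<noteq> 0")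
    case True
    then obtain z where z: "z \<in> V" "z \<noteq> 0"
      by blast
    then have "N z > 0"
      using normed_on_nonneg[OF n z(1)] normed_on_eq_zero[OF n z(1)] by linarith
    moreover have "0 \<le> antidual_norm V N x * N z"
      using cmod_cinner_le_antidual_norm[OF z(1), of x] norm_ge_zero order_trans by blast
    ultimately show ?thesis
      by (simp add: zero_le_mult_iff)
  next
    case False
    then have "{z \<in> V. N z \<le> 1} = {0}"
      using normed_on_zero[OF n] normed_on_norm_zero[OF n] by auto
    then show ?thesis
      by (simp add: antidual_norm_def functional_norm_def cinner_simps)
  qed
qed

lemma antidual_norm_scaleR_le: "antidual_norm V N (t *\<^sub>R x) \<le> \<bar>t\<bar> * antidual_norm V N x"
proof (rule antidual_norm_le[OF normed_on_if_embedded])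
  show "0 \<le> \<bar>t\<bar> * antidual_norm V N x"
    by (simp add: antidual_norm_nonneg)
  fix z
  assume "z \<in> V"
  then show "cmod (cinner (t *\<^sub>R x) z) \<le> \<bar>t\<bar> * antidual_norm V N x * N z"
    using mult_left_mono[OF cmod_cinner_le_antidual_norm[of z x], of "\<bar>t\<bar>"]
    by (simp add: scaleR_scaleC cinner_simps norm_mult)
qed

text \<open>If no \<open>c\<close> works, normalise the counterexample for \<open>c = m + 1\<close> to \<open>y\<^sub>m\<close> with \<open>N (B y\<^sub>m) = 1\<close>. Then
  \<open>p (y\<^sub>m) \<le> 1/e\<close>, and \<open>y\<^sub>m\<close> tends to 0 in the anti-dual norm. A subsequence of \<open>B y\<^sub>m\<close> converges
  to some \<open>l\<close> of norm at least 1, but \<open>(l, w) = lim (y\<^sub>m, B w) = 0\<close> for \<open>w\<close> in the dense set \<open>D\<close>. In other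
  words, a symmetric operator is closable from the anti-dual, which is what makes the bound small.\<close>

lemma small_relative_bound_if_compact:
  fixes p :: "'g \<Rightarrow> real" and B :: "'g \<Rightarrow> 'g"
  assumes D: "complex_vector.subspace D" "closure D = UNIV"
    and B: "clinear_on D B" "\<And>x. x \<in> D \<Longrightarrow> B x \<in> V"
      "\<And>x y. x \<in> D \<Longrightarrow> y \<in> D \<Longrightarrow> cinner (B x) y = cinner x (B y)"
    and p: "\<And>x. x \<in> D \<Longrightarrow> p x \<ge> 0" "\<And>t x. x \<in> D \<Longrightarrow> p (t *\<^sub>R x) = \<bar>t\<bar> * p x"
    and comp: "\<And>x. range x \<subseteq> D \<Longrightarrow> (\<exists>K. \<forall>n. antidual_norm V N (x n) + p (x n) \<le> K) \<Longrightarrow>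
      \<exists>r :: nat \<Rightarrow> nat. strict_mono r \<and> converges_in V N (\<lambda>n. B (x (r n)))"
    and e: "e > 0"
  shows "\<exists>c>0. \<forall>x\<in>D. N (B x) \<le> c * antidual_norm V N x + e * p x"
proof -
  note n = normed_on_if_embedded
  obtain K where K: "K \<ge> 0" "\<And>z. z \<in> V \<Longrightarrow> norm z \<le> K * N z"
    using embedded_obtain[OF V] by blast
  have "\<exists>m::nat. \<forall>x\<in>D. N (B x) \<le> real (Suc m) * antidual_norm V N x + e * p x"
  proof (rule ccontr)
    assume "\<not> ?thesis"
    then have "\<exists>x\<in>D. N (B x) > real (Suc m) * antidual_norm V N x + e * p x" for m
      by (meson not_le)
    then obtain x where x: "\<And>m. x m \<in> D"
      "\<And>m. N (B (x m)) > real (Suc m) * antidual_norm V N (x m) + e * p (x m)"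
      by metis
    define t where "t m = N (B (x m))" for m
    define y where "y m = (1 / t m) *\<^sub>R x m" for m
    have t: "t m > 0" for m
    proof -
      have "0 \<le> real (Suc m) * antidual_norm V N (x m) + e * p (x m)"
        using e p(1)[OF x(1)] antidual_norm_nonneg by (intro add_nonneg_nonneg mult_nonneg_nonneg) auto
      then show ?thesis
        using x(2)[of m] by (simp add: t_def)
    qed
    have yD: "y m \<in> D" for m
      unfolding y_def scaleR_scaleC using D(1) x(1) by (rule complex_vector.subspace_scale)
    have By: "B (y m) = (1 / t m) *\<^sub>R B (x m)" for m
      unfolding y_def scaleR_scaleC using B(1) x(1) by (simp add: clinear_on_def)
    have NBy: "N (B (y m)) = 1" for m
      using t[of m] by (simp add: By normed_on_norm_scaleR[OF n B(2)[OF x(1)]] t_def[symmetric])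
    have small: "real (Suc m) * antidual_norm V N (y m) + e * p (y m) \<le> 1" for m
    proof -
      have "real (Suc m) * antidual_norm V N (y m) + e * p (y m)
          \<le> real (Suc m) * (\<bar>1 / t m\<bar> * antidual_norm V N (x m)) + e * (\<bar>1 / t m\<bar> * p (x m))"
        unfolding y_def p(2)[OF x(1)]
        by (intro add_mono mult_left_mono antidual_norm_scaleR_le order_refl) simp
      also have "\<dots> = (real (Suc m) * antidual_norm V N (x m) + e * p (x m)) / t m"
        using t[of m] by (simp add: field_simps)
      also have "\<dots> \<le> 1"
        using x(2)[of m] t[of m] by (simp add: t_def[symmetric] del: of_nat_Suc)
      finally show ?thesis .
    qed
    have ad: "antidual_norm V N (y m) \<le> inverse (real (Suc m))" for m
    proof -
      have "e * p (y m) \<ge> 0"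
        using e p(1)[OF yD] by simp
      then have "real (Suc m) * antidual_norm V N (y m) \<le> 1"
        using small[of m] by linarith
      then show ?thesis
        by (simp add: field_simps)
    qed
    have "antidual_norm V N (y m) + p (y m) \<le> 1 + 1 / e" for m
    proof -
      have "real (Suc m) * antidual_norm V N (y m) \<ge> 0"
        by (simp add: antidual_norm_nonneg)
      then have "e * p (y m) \<le> 1"
        using small[of m] by linarith
      then have "p (y m) \<le> 1 / e"
        using e by (simp add: field_simps)
      moreover have "inverse (real (Suc m)) \<le> 1"
        by (simp add: field_simps)
      ultimately show ?thesis
        using ad[of m] by linarith
    qed
    then obtain r :: "nat \<Rightarrow> nat" where r: "strict_mono r" "converges_in V N (\<lambda>m. B (y (r m)))"
      using comp[of y] yD by blast
    then obtain l where l: "l \<in> V" "(\<lambda>m. N (B (y (r m)) - l)) \<longlonglongrightarrow> 0"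
      unfolding converges_in_def by blast
    have BV: "B (y m) \<in> V" for m
      by (rule B(2)[OF yD])
    have "1 \<le> N l"
    proof -
      have "1 \<le> N (B (y (r m)) - l) + N l" for m
        using normed_on_triangle[OF n normed_on_diff[OF n BV l(1)] l(1), of "r m"] NBy[of "r m"] by simp
      moreover have "(\<lambda>m. N (B (y (r m)) - l) + N l) \<longlonglongrightarrow> 0 + N l"
        by (intro tendsto_intros l)
      ultimately show ?thesis
        using LIMSEQ_le_const[of _ "0 + N l" 1] by auto
    qed
    have lim: "(\<lambda>m. B (y (r m))) \<longlonglongrightarrow> l"
    proof -
      have "(\<lambda>m. B (y (r m)) - l) \<longlonglongrightarrow> 0"
      proof (rule Lim_null_comparison)
        show "\<forall>\<^sub>F m in sequentially. norm (B (y (r m)) - l) \<le> K * N (B (y (r m)) - l)"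
          using K(2)[OF normed_on_diff[OF n BV l(1)]] by simp
        show "(\<lambda>m. K * N (B (y (r m)) - l)) \<longlonglongrightarrow> 0"
          using tendsto_mult_right_zero[OF l(2)] .
      qed
      then show ?thesis
        by (rule LIM_zero_cancel)
    qed
    have orth: "cinner l w = 0" if w: "w \<in> D" for w
    proof -
      have "(\<lambda>m. cinner (B (y (r m))) w - cinner l w) \<longlonglongrightarrow> 0"
      proof (rule Lim_null_comparison)
        show "\<forall>\<^sub>F m in sequentially. norm (cinner (B (y (r m))) w - cinner l w)
            \<le> norm (B (y (r m)) - l) * norm w"
          unfolding cinner_diff_left[symmetric] by (intro always_eventually allI cmod_cinner_le)
        show "(\<lambda>m. norm (B (y (r m)) - l) * norm w) \<longlonglongrightarrow> 0"
          using tendsto_mult_left_zero[OF tendsto_norm_zero[OF LIM_zero[OF lim]]] .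
      qed
      then have l1: "(\<lambda>m. cinner (B (y (r m))) w) \<longlonglongrightarrow> cinner l w"
        by (rule LIM_zero_cancel)
      have "(\<lambda>m. cinner (B (y (r m))) w) \<longlonglongrightarrow> 0"
      proof (rule Lim_null_comparison)
        have "cmod (cinner (B (y (r m))) w) \<le> inverse (real (Suc m)) * N (B w)" for m
        proof -
          have "cmod (cinner (B (y (r m))) w) = cmod (cinner (y (r m)) (B w))"
            using B(3)[OF yD w] by simp
          also have "\<dots> \<le> antidual_norm V N (y (r m)) * N (B w)"
            by (rule cmod_cinner_le_antidual_norm[OF B(2)[OF w]])
          also have "\<dots> \<le> inverse (real (Suc m)) * N (B w)"
          proof (rule mult_right_mono)
            show "antidual_norm V N (y (r m)) \<le> inverse (real (Suc m))"
              by (rule order_trans[OF ad le_imp_inverse_le])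
                (use strict_mono_imp_increasing[OF r(1), of m] in simp_all)
          qed (rule normed_on_nonneg[OF n B(2)[OF w]])
          finally show ?thesis .
        qed
        then show "\<forall>\<^sub>F m in sequentially. norm (cinner (B (y (r m))) w) \<le> inverse (real (Suc m)) * N (B w)"
          by simp
        show "(\<lambda>m. inverse (real (Suc m)) * N (B w)) \<longlonglongrightarrow> 0"
          using tendsto_mult_left_zero[OF LIMSEQ_inverse_real_of_nat] .
      qed
      then show ?thesis
        using l1 LIMSEQ_unique by blast
    qed
    have "l \<in> closure D"
      using D(2) by simp
    then obtain w where w: "\<And>m. w m \<in> D" "w \<longlonglongrightarrow> l"
      using closure_sequential by blast
    have "(\<lambda>m. inner l (w m)) \<longlonglongrightarrow> inner l l"
      by (intro tendsto_intros w)
    moreover have "inner l (w m) = 0" for m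
      using orth[OF w(1)] by (simp add: inner_eq_Re_cinner)
    ultimately have "(\<lambda>m::nat. 0) \<longlonglongrightarrow> inner l l"
      by simp
    then have "0 = inner l l"
      by (rule LIMSEQ_unique[OF tendsto_const])
    then have "N l = 0"
      using normed_on_norm_zero[OF n] by simp
    then show False
      using \<open>1 \<le> N l\<close> by simp
  qed
  then obtain m :: nat where "\<forall>x\<in>D. N (B x) \<le> real (Suc m) * antidual_norm V N x + e * p x"
    by blast
  then show ?thesis
    by (intro exI[of _ "real (Suc m)"]) simp
qed

end

section \<open>Boundary maps satisfying the Green identity\<close>

text \<open>The resolvent identity: continuity of the boundary map composed with one resolvent carries over to
  every point \<open>c\<close> of the resolvent set.\<close>

lemma resolvent_trace_bound:
  assumes S: "linear_operator S" "S \<subseteq> T" and c: "c \<in> resolvent_set S"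
    and bd: "\<exists>l\<in>resolvent_set S. bounded_op norm N ((op_shift S (cnj l))\<inverse> O graph_on (Domain T) G)"
  obtains K where "K \<ge> 0" "\<And>f f'. (f, f') \<in> S \<Longrightarrow> N (G f) \<le> K * norm (f' - c *\<^sub>C f)"
proof -
  obtain l where "bounded_op norm N ((op_shift S (cnj l))\<inverse> O graph_on (Domain T) G)"
    using bd by blast
  then obtain K where K: "\<And>h y. (h, y) \<in> (op_shift S (cnj l))\<inverse> O graph_on (Domain T) G \<Longrightarrow>
      N y \<le> K * norm h"
    unfolding bounded_op_def by blast
  obtain R L where L: "L \<ge> 0" and R: "\<And>h. norm (R h) \<le> L * norm h"
    "\<And>f f'. (f, f') \<in> S \<Longrightarrow> R (f' - c *\<^sub>C f) = f"
    using resolventE[OF S(1) c] by metis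
  define d where "d = c - cnj l"
  show thesis
  proof
    show "\<bar>K\<bar> * (1 + cmod d * L) \<ge> 0"
      using L by simp
    fix f f'
    assume f: "(f, f') \<in> S"
    define h where "h = f' - c *\<^sub>C f"
    have fh: "norm f \<le> L * norm h"
      using R(1)[of h] R(2)[OF f] by (simp add: h_def)
    have eq: "f' - cnj l *\<^sub>C f = h + d *\<^sub>C f"
      by (simp add: h_def d_def complex_vector.scale_left_diff_distrib)
    have "(f' - cnj l *\<^sub>C f, f) \<in> (op_shift S (cnj l))\<inverse>"
      using f by (simp add: op_shift_iff)
    moreover have "(f, G f) \<in> graph_on (Domain T) G"
      using f S(2) by (auto simp: graph_on_def)
    ultimately have "N (G f) \<le> K * norm (h + d *\<^sub>C f)"
      using K[OF relcompI] unfolding eq by blast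
    also have "\<dots> \<le> \<bar>K\<bar> * (norm h + cmod d * norm f)"
      using norm_triangle_ineq[of h "d *\<^sub>C f"] by (intro mult_mono) (auto simp: norm_scaleC)
    also have "\<dots> \<le> \<bar>K\<bar> * (norm h + cmod d * (L * norm h))"
      by (intro mult_left_mono add_left_mono fh) auto
    also have "\<dots> = \<bar>K\<bar> * (1 + cmod d * L) * norm (f' - c *\<^sub>C f)"
      by (simp add: h_def algebra_simps)
    finally show "N (G f) \<le> \<bar>K\<bar> * (1 + cmod d * L) * norm (f' - c *\<^sub>C f)" .
  qed
qed

lemma op_restrict_subset: "op_restrict S D \<subseteq> S"
  by (auto simp: op_restrict_def)

locale boundary_maps =
  fixes T :: "('h::complex_hilbert \<times> 'h) set"
    and \<Gamma>0 \<Gamma>1 :: "'h \<Rightarrow> 'g::complex_hilbert"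
  assumes linear_T: "linear_operator T"
    and linear_\<Gamma>0: "clinear_on (Domain T) \<Gamma>0"
    and linear_\<Gamma>1: "clinear_on (Domain T) \<Gamma>1"
    and green: "(f, f') \<in> T \<Longrightarrow> (g, g') \<in> T \<Longrightarrow>
      cinner f' g - cinner f g' = cinner (\<Gamma>1 f) (\<Gamma>0 g) - cinner (\<Gamma>0 f) (\<Gamma>1 g)"
begin

abbreviation "A0 \<equiv> op_restrict T {f. \<Gamma>0 f = 0}"
abbreviation "A1 \<equiv> op_restrict T {f. \<Gamma>1 f = 0}"
abbreviation "G0 \<equiv> \<Gamma>0 ` {f \<in> Domain T. \<Gamma>1 f = 0}"
abbreviation "G1 \<equiv> \<Gamma>1 ` {f \<in> Domain T. \<Gamma>0 f = 0}"

lemma subspace_Domain: "complex_vector.subspace (Domain T)"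
  using linear_operator_zero[OF linear_T] linear_operator_add[OF linear_T]
    linear_operator_scaleC[OF linear_T]
  unfolding complex_vector.subspace_def by blast

lemma \<Gamma>_add:
  assumes "(f, f') \<in> T" "(g, g') \<in> T"
  shows "\<Gamma>0 (f + g) = \<Gamma>0 f + \<Gamma>0 g" "\<Gamma>1 (f + g) = \<Gamma>1 f + \<Gamma>1 g"
  using assms linear_\<Gamma>0 linear_\<Gamma>1 unfolding clinear_on_def by (meson DomainI)+

lemma \<Gamma>_diff:
  assumes "(f, f') \<in> T" "(g, g') \<in> T"
  shows "\<Gamma>0 (f - g) = \<Gamma>0 f - \<Gamma>0 g" "\<Gamma>1 (f - g) = \<Gamma>1 f - \<Gamma>1 g"
  using assms clinear_on_diff[OF linear_\<Gamma>0 subspace_Domain] clinear_on_diff[OF linear_\<Gamma>1 subspace_Domain]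
  by blast+

lemma \<Gamma>_scaleC:
  assumes "(f, f') \<in> T"
  shows "\<Gamma>0 (c *\<^sub>C f) = c *\<^sub>C \<Gamma>0 f" "\<Gamma>1 (c *\<^sub>C f) = c *\<^sub>C \<Gamma>1 f"
  using assms linear_\<Gamma>0 linear_\<Gamma>1 unfolding clinear_on_def by (meson DomainI)+

lemma \<Gamma>_zero: "\<Gamma>0 0 = 0" "\<Gamma>1 0 = 0"
  using \<Gamma>_diff[OF linear_operator_zero[OF linear_T] linear_operator_zero[OF linear_T]] by simp_all

lemma mem_A0: "(f, f') \<in> A0 \<longleftrightarrow> (f, f') \<in> T \<and> \<Gamma>0 f = 0"
  by (simp add: op_restrict_def)

lemma mem_A1: "(f, f') \<in> A1 \<longleftrightarrow> (f, f') \<in> T \<and> \<Gamma>1 f = 0"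
  by (simp add: op_restrict_def)

lemma mem_G0: "x \<in> G0 \<longleftrightarrow> (\<exists>f f'. (f, f') \<in> A1 \<and> \<Gamma>0 f = x)"
  by (auto simp: mem_A1)

lemma mem_G1: "x \<in> G1 \<longleftrightarrow> (\<exists>f f'. (f, f') \<in> A0 \<and> \<Gamma>1 f = x)"
  by (auto simp: mem_A0)

lemma linear_restrict:
  assumes "0 \<in> D" "\<And>f f' g g'. (f, f') \<in> T \<Longrightarrow> (g, g') \<in> T \<Longrightarrow> f \<in> D \<Longrightarrow> g \<in> D \<Longrightarrow> f + g \<in> D"
    "\<And>c f f'. (f, f') \<in> T \<Longrightarrow> f \<in> D \<Longrightarrow> c *\<^sub>C f \<in> D"
  shows "linear_operator (op_restrict T D)"
  using assms linear_T linear_operator_zero[OF linear_T] linear_operator_add[OF linear_T]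
    linear_operator_scaleC[OF linear_T]
  unfolding linear_operator_def[of "op_restrict T D"] complex_vector.subspace_def single_valued_def
  by (auto simp: op_restrict_def scaleC_prod_def zero_prod_def dest: linear_operator_unique[OF linear_T])

lemma linear_A0: "linear_operator A0"
  by (rule linear_restrict) (auto simp: \<Gamma>_zero \<Gamma>_add \<Gamma>_scaleC)

lemma linear_A1: "linear_operator A1"
  by (rule linear_restrict) (auto simp: \<Gamma>_zero \<Gamma>_add \<Gamma>_scaleC)

lemma subspace_G0: "complex_vector.subspace G0"
proof (rule complex_vector.subspaceI)
  show "0 \<in> G0"
    unfolding mem_G0 using linear_operator_zero[OF linear_A1] \<Gamma>_zero(1) by blast
next
  fix x y
  assume "x \<in> G0" "y \<in> G0"
  then obtain f f' g g' where f: "(f, f') \<in> A1" "\<Gamma>0 f = x" and g: "(g, g') \<in> A1" "\<Gamma>0 g = y"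
    by (auto simp only: mem_G0)
  have "\<Gamma>0 (f + g) = x + y"
    using \<Gamma>_add(1)[of f f' g g'] f g by (simp add: mem_A1)
  then show "x + y \<in> G0"
    unfolding mem_G0 using linear_operator_add[OF linear_A1 f(1) g(1)] by blast
next
  fix c x
  assume "x \<in> G0"
  then obtain f f' where f: "(f, f') \<in> A1" "\<Gamma>0 f = x"
    by (auto simp only: mem_G0)
  have "\<Gamma>0 (c *\<^sub>C f) = c *\<^sub>C x"
    using \<Gamma>_scaleC(1)[of f f' c] f by (simp add: mem_A1)
  then show "c *\<^sub>C x \<in> G0"
    unfolding mem_G0 using linear_operator_scaleC[OF linear_A1 f(1)] by blast
qed

text \<open>Subtracting an element of \<open>A1\<close> with the same value of \<open>\<Gamma>0\<close> leaves \<open>\<Gamma>1 f\<close> unchanged and leads to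
  \<open>A0\<close>. For \<open>f\<close> in the kernel of \<open>T - \<eta>\<close> this says that \<open>M \<eta>\<close> maps \<open>G0\<close> into \<open>G1\<close>.\<close>

lemma \<Gamma>1_in_G1_if_\<Gamma>0_in_G0:
  assumes f: "(f, f') \<in> T" and x: "\<Gamma>0 f \<in> G0"
  shows "\<Gamma>1 f \<in> G1"
proof -
  obtain g g' where g: "(g, g') \<in> A1" "\<Gamma>0 g = \<Gamma>0 f"
    using x by (auto simp only: mem_G0)
  then have "(f - g, f' - g') \<in> A0" "\<Gamma>1 (f - g) = \<Gamma>1 f"
    using linear_operator_diff[OF linear_T f] \<Gamma>_diff[OF f] by (auto simp: mem_A0 mem_A1)
  then show ?thesis
    by (auto simp only: mem_G1)
qed

end

locale regularized_boundary_maps = boundary_maps T \<Gamma>0 \<Gamma>1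
  for T :: "('h::complex_hilbert \<times> 'h) set" and \<Gamma>0 \<Gamma>1 :: "'h \<Rightarrow> 'g::complex_hilbert" +
  fixes \<eta> :: complex and N1 :: "'g \<Rightarrow> real"
  assumes \<eta>: "\<eta> \<in> resolvent_set A0" "\<eta> \<in> \<real>"
    and banach_G1: "banach_on G1 N1"
    and cont1: "\<exists>l\<in>resolvent_set A0.
      bounded_op norm N1 ((op_shift A0 (cnj l))\<inverse> O graph_on (Domain T) \<Gamma>1)"
begin

lemma normed_G1: "normed_on G1 N1"
  using banach_G1 by (simp add: banach_on_def)

text \<open>The open mapping theorem for \<open>\<Gamma>1 (A0 - \<eta>)\<inverse>\<close>, which by the Green identity is the adjoint of the
  \<open>\<gamma>\<close>-field at \<open>\<eta>\<close>.\<close>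

lemma boundary_lift:
  obtains C where "C \<ge> 0" "\<And>z. z \<in> G1 \<Longrightarrow>
    \<exists>f f'. (f, f') \<in> A0 \<and> \<Gamma>1 f = z \<and> norm (f' - \<eta> *\<^sub>C f) \<le> C * N1 z \<and> norm f \<le> C * N1 z"
proof -
  obtain R L where L: "L \<ge> 0" and R: "clinear_on UNIV R" "\<And>h. (R h, h + \<eta> *\<^sub>C R h) \<in> A0"
    "\<And>h. norm (R h) \<le> L * norm h" "\<And>f f'. (f, f') \<in> A0 \<Longrightarrow> R (f' - \<eta> *\<^sub>C f) = f"
    using resolventE[OF linear_A0 \<eta>(1)] by metis
  obtain K where K: "\<And>f f'. (f, f') \<in> A0 \<Longrightarrow> N1 (\<Gamma>1 f) \<le> K * norm (f' - \<eta> *\<^sub>C f)"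
    using resolvent_trace_bound[OF linear_A0 op_restrict_subset \<eta>(1) cont1] by metis
  define Q where "Q h = \<Gamma>1 (R h)" for h
  have RT: "(R h, h + \<eta> *\<^sub>C R h) \<in> T" for h
    using R(2) by (simp add: mem_A0)
  have "linear Q"
    using R(1) unfolding Q_def clinear_on_def
    by (intro linearI) (simp_all add: scaleR_scaleC \<Gamma>_add(2)[OF RT RT] \<Gamma>_scaleC(2)[OF RT])
  moreover have "range Q = G1"
  proof (intro equalityI subsetI)
    fix z
    assume "z \<in> range Q"
    then show "z \<in> G1"
      unfolding mem_G1 Q_def using R(2) by blast
  next
    fix z
    assume "z \<in> G1"
    then obtain f f' where "(f, f') \<in> A0" "\<Gamma>1 f = z"
      unfolding mem_G1 by blast
    then have "Q (f' - \<eta> *\<^sub>C f) = z"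
      by (simp add: Q_def R(4))
    then show "z \<in> range Q"
      by blast
  qed
  moreover have "N1 (Q h) \<le> K * norm h" for h
    using K[OF R(2)[of h]] by (simp add: Q_def)
  ultimately obtain C where C: "C \<ge> 0" "\<And>z. z \<in> G1 \<Longrightarrow> \<exists>h. Q h = z \<and> norm h \<le> C * N1 z"
    using open_mapping[OF banach_G1, of Q K] by blast
  show thesis
  proof
    show "C * (1 + L) \<ge> 0"
      using C L by simp
    fix z
    assume z: "z \<in> G1"
    then obtain h where h: "Q h = z" "norm h \<le> C * N1 z"
      using C by blast
    have CN: "0 \<le> C * N1 z"
      using C(1) normed_on_nonneg[OF normed_G1 z] by simp
    have "norm (R h) \<le> L * (C * N1 z)"
      using R(3)[of h] mult_left_mono[OF h(2) L] by simp
    moreover have "C * (1 + L) * N1 z = C * N1 z + L * (C * N1 z)"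
      by (simp add: algebra_simps)
    moreover have "0 \<le> L * (C * N1 z)"
      using L CN by simp
    ultimately have "norm ((h + \<eta> *\<^sub>C R h) - \<eta> *\<^sub>C R h) \<le> C * (1 + L) * N1 z"
      "norm (R h) \<le> C * (1 + L) * N1 z"
      using h(2) CN by simp_all
    then show "\<exists>f f'. (f, f') \<in> A0 \<and> \<Gamma>1 f = z \<and> norm (f' - \<eta> *\<^sub>C f) \<le> C * (1 + L) * N1 z \<and>
        norm f \<le> C * (1 + L) * N1 z"
      using R(2)[of h] h(1) unfolding Q_def by blast
  qed
qed

text \<open>\<open>\<Gamma>0\<close> is bounded from the kernel of \<open>T - c\<close>, with the norm of the Hilbert space, into the anti-dual of
  \<open>G1\<close>: lift \<open>z\<close> to \<open>f\<close> in the domain of \<open>A0\<close> with \<open>\<Gamma>1 f = z\<close> and control, and express the pairing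
  through the Green identity for \<open>u\<close> and \<open>f\<close>.\<close>

lemma boundary_pairing_bound:
  obtains C where "C \<ge> 0" "\<And>u z. (u, c *\<^sub>C u) \<in> T \<Longrightarrow> z \<in> G1 \<Longrightarrow>
    cmod (cinner (\<Gamma>0 u) z) \<le> C * norm u * N1 z"
proof -
  obtain C where C: "C \<ge> 0" "\<And>z. z \<in> G1 \<Longrightarrow>
      \<exists>f f'. (f, f') \<in> A0 \<and> \<Gamma>1 f = z \<and> norm (f' - \<eta> *\<^sub>C f) \<le> C * N1 z \<and> norm f \<le> C * N1 z"
    using boundary_lift by blast
  show thesis
  proof
    show "C * (cmod (c - \<eta>) + 1) \<ge> 0"
      using C by simp
    fix u z
    assume u: "(u, c *\<^sub>C u) \<in> T" and z: "z \<in> G1"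
    obtain f f' where f: "(f, f') \<in> A0" "\<Gamma>1 f = z" "norm (f' - \<eta> *\<^sub>C f) \<le> C * N1 z" "norm f \<le> C * N1 z"
      using C(2)[OF z] by blast
    have fT: "(f, f') \<in> T" "\<Gamma>0 f = 0"
      using f(1) by (simp_all add: mem_A0)
    have "cinner (\<Gamma>0 u) z = cinner u f' - cinner (c *\<^sub>C u) f"
      using green[OF u fT(1)] fT(2) f(2) by (simp add: cinner_simps algebra_simps)
    also have "\<dots> = cinner u (f' - \<eta> *\<^sub>C f) - cinner ((c - \<eta>) *\<^sub>C u) f"
      using \<eta>(2) by (simp add: cinner_simps Reals_cnj_iff algebra_simps)
    also have "cmod \<dots> \<le> norm u * norm (f' - \<eta> *\<^sub>C f) + (cmod (c - \<eta>) * norm u) * norm f"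
      using norm_triangle_ineq4 cmod_cinner_le[of u "f' - \<eta> *\<^sub>C f"] cmod_cinner_le[of "(c - \<eta>) *\<^sub>C u" f]
      unfolding norm_scaleC by (meson add_mono order_trans)
    also have "\<dots> \<le> norm u * (C * N1 z) + (cmod (c - \<eta>) * norm u) * (C * N1 z)"
      by (intro add_mono mult_left_mono f) auto
    also have "\<dots> = C * (cmod (c - \<eta>) + 1) * norm u * N1 z"
      by (simp add: algebra_simps)
    finally show "cmod (cinner (\<Gamma>0 u) z) \<le> C * (cmod (c - \<eta>) + 1) * norm u * N1 z" .
  qed
qed

lemma weyl_iff: "(x, y) \<in> weyl_function T \<Gamma>0 \<Gamma>1 \<eta> \<longleftrightarrow>
  (\<exists>g. (g, \<eta> *\<^sub>C g) \<in> T \<and> \<Gamma>0 g = x \<and> \<Gamma>1 g = y)"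
  unfolding weyl_function_def gamma_field_def graph_on_def by auto

lemma eq_zero_if_kernel_A0:
  assumes "(g, \<eta> *\<^sub>C g) \<in> A0"
  shows "g = 0"
proof -
  obtain R K where "clinear_on UNIV R" "\<And>f f'. (f, f') \<in> A0 \<Longrightarrow> R (f' - \<eta> *\<^sub>C f) = f"
    "\<And>h. norm (R h) \<le> K * norm h"
    using resolventE[OF linear_A0 \<eta>(1)] by metis
  from this(2)[OF assms] this(3)[of 0] show ?thesis
    by simp
qed

lemma op_app_weyl:
  assumes g: "(g, \<eta> *\<^sub>C g) \<in> T"
  shows "op_app (weyl_function T \<Gamma>0 \<Gamma>1 \<eta>) (\<Gamma>0 g) = \<Gamma>1 g"
  unfolding op_app_def
proof (rule the_equality)
  show "(\<Gamma>0 g, \<Gamma>1 g) \<in> weyl_function T \<Gamma>0 \<Gamma>1 \<eta>"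
    using g by (auto simp: weyl_iff)
  fix y
  assume "(\<Gamma>0 g, y) \<in> weyl_function T \<Gamma>0 \<Gamma>1 \<eta>"
  then obtain k where k: "(k, \<eta> *\<^sub>C k) \<in> T" "\<Gamma>0 k = \<Gamma>0 g" "\<Gamma>1 k = y"
    by (auto simp: weyl_iff)
  have "(k - g, \<eta> *\<^sub>C (k - g)) \<in> A0"
    using linear_operator_diff[OF linear_T k(1) g] \<Gamma>_diff[OF k(1) g] k(2)
    by (simp add: mem_A0 complex_vector.scale_right_diff_distrib)
  then have "k = g"
    using eq_zero_if_kernel_A0 by fastforce
  then show "y = \<Gamma>1 g"
    using k by simp
qed

text \<open>The decomposition of the domain of \<open>T\<close> into the domain of \<open>A0\<close> and the kernel of \<open>T - \<eta>\<close>.\<close>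

lemma kernel_component:
  assumes f: "(f, f') \<in> T"
  obtains g where "(g, \<eta> *\<^sub>C g) \<in> T" "\<Gamma>0 g = \<Gamma>0 f"
    "(f - g, (f' - \<eta> *\<^sub>C f) + \<eta> *\<^sub>C (f - g)) \<in> A0"
proof -
  obtain R K where R: "clinear_on UNIV R" "\<And>h. (R h, h + \<eta> *\<^sub>C R h) \<in> A0"
    "\<And>h. norm (R h) \<le> K * norm h"
    using resolventE[OF linear_A0 \<eta>(1)] by metis
  define w where "w = R (f' - \<eta> *\<^sub>C f)"
  have w: "(w, (f' - \<eta> *\<^sub>C f) + \<eta> *\<^sub>C w) \<in> A0"
    using R(2) by (simp add: w_def)
  then have wT: "(w, (f' - \<eta> *\<^sub>C f) + \<eta> *\<^sub>C w) \<in> T" "\<Gamma>0 w = 0"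
    by (simp_all add: mem_A0)
  show thesis
  proof
    show "(f - w, \<eta> *\<^sub>C (f - w)) \<in> T"
      using linear_operator_diff[OF linear_T f wT(1)]
      by (simp add: complex_vector.scale_right_diff_distrib)
    show "\<Gamma>0 (f - w) = \<Gamma>0 f"
      using \<Gamma>_diff[OF f wT(1)] wT(2) by simp
    show "(f - (f - w), (f' - \<eta> *\<^sub>C f) + \<eta> *\<^sub>C (f - (f - w))) \<in> A0"
      using w by simp
  qed
qed

lemma G0_obtain:
  assumes "x \<in> G0"
  obtains g where "(g, \<eta> *\<^sub>C g) \<in> T" "\<Gamma>0 g = x" "\<Gamma>1 g \<in> G1"
proof -
  obtain f f' where f: "(f, f') \<in> A1" "\<Gamma>0 f = x"
    using assms by (auto simp only: mem_G0)
  obtain g where g: "(g, \<eta> *\<^sub>C g) \<in> T" "\<Gamma>0 g = \<Gamma>0 f"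
    using kernel_component[of f f'] f(1) by (auto simp: mem_A1)
  have "\<Gamma>1 g \<in> G1"
    using \<Gamma>1_in_G1_if_\<Gamma>0_in_G0[OF g(1)] assms g(2) f(2) by simp
  then show thesis
    using that[of g] g f(2) by simp
qed

text \<open>If \<open>g\<close> in the kernel of \<open>T - \<eta>\<close> has \<open>\<Gamma>0 g = x\<close>, and \<open>f\<close> in the domain of \<open>A0\<close> lifts \<open>\<Gamma>1 g = M \<eta> x\<close>,
  then \<open>g - f\<close> is in the domain of \<open>A1\<close>, and \<open>\<Gamma>0\<close> still has the value \<open>x\<close> there. So \<open>x\<close> is bounded by
  \<open>(T - \<eta>) f\<close>, which is bounded by \<open>M \<eta> x\<close>.\<close>

lemma weyl_inverse_bound:
  assumes \<eta>1: "\<eta> \<in> resolvent_set A1"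
    and cont0: "\<exists>l\<in>resolvent_set A1.
      bounded_op norm N0 ((op_shift A1 (cnj l))\<inverse> O graph_on (Domain T) \<Gamma>0)"
  obtains C where "C > 0" "\<And>x. x \<in> G0 \<Longrightarrow> N0 x \<le> C * N1 (op_app (weyl_function T \<Gamma>0 \<Gamma>1 \<eta>) x)"
proof -
  obtain K where K: "K \<ge> 0" "\<And>f f'. (f, f') \<in> A1 \<Longrightarrow> N0 (\<Gamma>0 f) \<le> K * norm (f' - \<eta> *\<^sub>C f)"
    using resolvent_trace_bound[OF linear_A1 op_restrict_subset \<eta>1 cont0] by metis
  obtain C where C: "C \<ge> 0" "\<And>z. z \<in> G1 \<Longrightarrow>
      \<exists>f f'. (f, f') \<in> A0 \<and> \<Gamma>1 f = z \<and> norm (f' - \<eta> *\<^sub>C f) \<le> C * N1 z \<and> norm f \<le> C * N1 z"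
    using boundary_lift by blast
  show thesis
  proof
    show "K * C + 1 > 0"
      using K(1) C(1) by (simp add: add_nonneg_pos)
    fix x
    assume x: "x \<in> G0"
    obtain g where g: "(g, \<eta> *\<^sub>C g) \<in> T" "\<Gamma>0 g = x" "\<Gamma>1 g \<in> G1"
      using G0_obtain[OF x] .
    obtain f f' where f: "(f, f') \<in> A0" "\<Gamma>1 f = \<Gamma>1 g" "norm (f' - \<eta> *\<^sub>C f) \<le> C * N1 (\<Gamma>1 g)"
      using C(2)[OF g(3)] by blast
    have fT: "(f, f') \<in> T" "\<Gamma>0 f = 0"
      using f(1) by (simp_all add: mem_A0)
    have "(g - f, \<eta> *\<^sub>C g - f') \<in> A1"
      using linear_operator_diff[OF linear_T g(1) fT(1)] \<Gamma>_diff[OF g(1) fT(1)] f(2) by (simp add: mem_A1)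
    from K(2)[OF this] have "N0 x \<le> K * norm (\<eta> *\<^sub>C g - f' - \<eta> *\<^sub>C (g - f))"
      using \<Gamma>_diff[OF g(1) fT(1)] fT(2) g(2) by simp
    also have "\<eta> *\<^sub>C g - f' - \<eta> *\<^sub>C (g - f) = - (f' - \<eta> *\<^sub>C f)"
      by (simp add: complex_vector.scale_right_diff_distrib)
    also have "K * norm (- (f' - \<eta> *\<^sub>C f)) \<le> K * (C * N1 (\<Gamma>1 g))"
      unfolding norm_minus_cancel by (intro mult_left_mono f K)
    also have "\<dots> \<le> (K * C + 1) * N1 (\<Gamma>1 g)"
      using normed_on_nonneg[OF normed_G1 g(3)] by (simp add: algebra_simps)
    also have "\<Gamma>1 g = op_app (weyl_function T \<Gamma>0 \<Gamma>1 \<eta>) x"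
      using op_app_weyl[OF g(1)] g(2) by simp
    finally show "N0 x \<le> (K * C + 1) * N1 (op_app (weyl_function T \<Gamma>0 \<Gamma>1 \<eta>) x)" .
  qed
qed

end

section \<open>The perturbed boundary condition\<close>

lemma op_app_mem:
  assumes "linear_operator S" "x \<in> Domain S"
  shows "(x, op_app S x) \<in> S"
  using assms op_app_eq by fastforce

lemma clinear_on_op_app:
  assumes S: "linear_operator S" and D: "D \<subseteq> Domain S"
  shows "clinear_on D (op_app S)"
  unfolding clinear_on_def
proof (intro conjI allI ballI)
  fix x y c
  assume x: "x \<in> D"
  then have xS: "(x, op_app S x) \<in> S"
    using op_app_mem[OF S] D by blast
  show "op_app S (c *\<^sub>C x) = c *\<^sub>C op_app S x"
    by (rule op_app_eq[OF S linear_operator_scaleC[OF S xS]])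
  assume y: "y \<in> D"
  then have yS: "(y, op_app S y) \<in> S"
    using op_app_mem[OF S] D by blast
  show "op_app S (x + y) = op_app S x + op_app S y"
    by (rule op_app_eq[OF S linear_operator_add[OF S xS yS]])
qed

lemma op_app_restrict: "x \<in> D \<Longrightarrow> op_app (op_restrict S D) x = op_app S x"
  by (simp add: op_app_def op_restrict_def)

context regularized_boundary_maps
begin

text \<open>The point is that \<open>C\<close> does not depend on \<open>s\<close>. The symmetry of \<open>s B\<close> removes the perturbation from
  the Green identity, so that \<open>u\<close> is bounded by the data \<open>y\<close> alone. In the relative bound the term
  \<open>N1 (B x)\<close> appears on the right with the factor \<open>c2 s\<close>, and \<open>c2 s \<le> c2 < 1\<close> lets it be absorbed.\<close>

lemma uniform_bound_in_kernel:
  fixes B :: "'g \<Rightarrow> 'g"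
  assumes B: "\<And>x. x \<in> G0 \<Longrightarrow> B x \<in> G1" "\<And>x. x \<in> G0 \<Longrightarrow> cinner (B x) x = cinner x (B x)"
    and c12: "0 \<le> c1" "0 \<le> c2" "c2 < 1"
    and rel: "\<And>x. x \<in> G0 \<Longrightarrow>
      N1 (B x) \<le> c1 * antidual_norm G1 N1 x + c2 * N1 (op_app (weyl_function T \<Gamma>0 \<Gamma>1 \<eta>) x)"
    and c: "Im c \<noteq> 0"
  obtains C where "\<And>s u. 0 \<le> s \<Longrightarrow> s \<le> 1 \<Longrightarrow> (u, c *\<^sub>C u) \<in> T \<Longrightarrow> \<Gamma>0 u \<in> G0 \<Longrightarrow>
    N1 (B (\<Gamma>0 u)) \<le> C * N1 (\<Gamma>1 u - s *\<^sub>R B (\<Gamma>0 u))"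
proof -
  note n = normed_G1
  obtain P where P: "P \<ge> 0" "\<And>u z. (u, c *\<^sub>C u) \<in> T \<Longrightarrow> z \<in> G1 \<Longrightarrow>
      cmod (cinner (\<Gamma>0 u) z) \<le> P * norm u * N1 z"
    using boundary_pairing_bound[of c] by blast
  obtain K where K: "K \<ge> 0" "\<And>f f'. (f, f') \<in> A0 \<Longrightarrow> N1 (\<Gamma>1 f) \<le> K * norm (f' - \<eta> *\<^sub>C f)"
    using resolvent_trace_bound[OF linear_A0 op_restrict_subset \<eta>(1) cont1] by metis
  define E where "E = c1 * P + c2 * (K * cmod (c - \<eta>))"
  have E: "E \<ge> 0"
    using c12 P(1) K(1) by (simp add: E_def)
  show thesis
  proof
    fix s :: real and u
    assume s: "0 \<le> s" "s \<le> 1" and u: "(u, c *\<^sub>C u) \<in> T" and x: "\<Gamma>0 u \<in> G0"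
    define x where "x = \<Gamma>0 u"
    define y where "y = \<Gamma>1 u - s *\<^sub>R B x"
    have xG: "x \<in> G0" and BG: "B x \<in> G1" and uG: "\<Gamma>1 u \<in> G1"
      using x B(1) \<Gamma>1_in_G1_if_\<Gamma>0_in_G0[OF u x] by (simp_all add: x_def)
    have yG: "y \<in> G1"
      unfolding y_def by (intro normed_on_diff[OF n] normed_on_scaleR[OF n] BG uG)
    have \<Gamma>1u: "\<Gamma>1 u = y + s *\<^sub>R B x"
      by (simp add: y_def)
    (* The terms with s B x cancel since B is symmetric. *)
    have unorm: "\<bar>Im c\<bar> * norm u \<le> P * N1 y"
    proof (cases "u = 0")
      case True
      then show ?thesis
        using P(1) normed_on_nonneg[OF n yG] by simp
    next
      case False
      have "(c - cnj c) * complex_of_real ((norm u)\<^sup>2) = cinner y x - cinner x y"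
        using green[OF u u] B(2)[OF xG]
        by (simp add: cinner_simps scaleR_scaleC cinner_self \<Gamma>1u x_def[symmetric] algebra_simps)
      then have "cmod ((c - cnj c) * complex_of_real ((norm u)\<^sup>2)) = cmod (cinner y x - cinner x y)"
        by simp
      also have "\<dots> \<le> cmod (cinner y x) + cmod (cinner x y)"
        by (rule norm_triangle_ineq4)
      also have "cmod (cinner y x) = cmod (cinner x y)"
        by (metis cinner_commute complex_mod_cnj)
      also have "cmod ((c - cnj c) * complex_of_real ((norm u)\<^sup>2)) = 2 * \<bar>Im c\<bar> * (norm u)\<^sup>2"
        by (simp add: complex_diff_cnj norm_mult norm_power)
      finally have "\<bar>Im c\<bar> * (norm u)\<^sup>2 \<le> cmod (cinner x y)"
        by simp
      also have "\<dots> \<le> P * norm u * N1 y"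
        unfolding x_def by (rule P(2)[OF u yG])
      finally have "norm u * (\<bar>Im c\<bar> * norm u) \<le> norm u * (P * N1 y)"
        by (simp add: power2_eq_square algebra_simps)
      then show ?thesis
        using False by simp
    qed
    have ad: "antidual_norm G1 N1 x \<le> P * norm u"
      using P(1) P(2)[OF u] by (intro antidual_norm_le[OF n]) (auto simp: x_def)
    (* Pass from c to \<eta>: here g is the element of the kernel of T - \<eta> with the same value
       of \<Gamma>0 as u, so that \<Gamma>1 g = M \<eta> x. *)
    obtain g where g: "(g, \<eta> *\<^sub>C g) \<in> T" "\<Gamma>0 g = \<Gamma>0 u"
      "(u - g, (c *\<^sub>C u - \<eta> *\<^sub>C u) + \<eta> *\<^sub>C (u - g)) \<in> A0"
      using kernel_component[OF u] .
    have wG: "\<Gamma>1 (u - g) \<in> G1"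
      using g(3) unfolding mem_G1 by blast
    have "N1 (\<Gamma>1 (u - g)) \<le> K * norm ((c *\<^sub>C u - \<eta> *\<^sub>C u) + \<eta> *\<^sub>C (u - g) - \<eta> *\<^sub>C (u - g))"
      by (rule K(2)[OF g(3)])
    also have "\<dots> = K * cmod (c - \<eta>) * norm u"
      by (simp add: complex_vector.scale_left_diff_distrib[symmetric] norm_scaleC)
    finally have w: "N1 (\<Gamma>1 (u - g)) \<le> K * cmod (c - \<eta>) * norm u" .
    have "op_app (weyl_function T \<Gamma>0 \<Gamma>1 \<eta>) x = \<Gamma>1 u - \<Gamma>1 (u - g)"
      using op_app_weyl[OF g(1)] g(2) \<Gamma>_diff[OF u g(1)] by (simp add: x_def)
    then have "N1 (op_app (weyl_function T \<Gamma>0 \<Gamma>1 \<eta>) x) \<le> N1 (\<Gamma>1 u) + N1 (\<Gamma>1 (u - g))"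
      using normed_on_triangle_minus[OF n uG wG] by simp
    moreover have "N1 (\<Gamma>1 u) \<le> N1 y + s * N1 (B x)"
      unfolding \<Gamma>1u using normed_on_triangle[OF n yG normed_on_scaleR[OF n BG], of s]
        normed_on_norm_scaleR[OF n BG, of s] s(1) by simp
    moreover have "s * N1 (B x) \<le> 1 * N1 (B x)"
      by (intro mult_right_mono s normed_on_nonneg[OF n BG])
    ultimately have "N1 (op_app (weyl_function T \<Gamma>0 \<Gamma>1 \<eta>) x)
        \<le> N1 y + N1 (B x) + K * cmod (c - \<eta>) * norm u"
      using w by linarith
    then have "c1 * antidual_norm G1 N1 x + c2 * N1 (op_app (weyl_function T \<Gamma>0 \<Gamma>1 \<eta>) x)
        \<le> c1 * (P * norm u) + c2 * (N1 y + N1 (B x) + K * cmod (c - \<eta>) * norm u)"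
      by (intro add_mono mult_left_mono ad c12)
    then have "N1 (B x) \<le> c1 * (P * norm u) + c2 * (N1 y + N1 (B x) + K * cmod (c - \<eta>) * norm u)"
      using rel[OF xG] by linarith
    then have "(1 - c2) * N1 (B x) \<le> E * norm u + c2 * N1 y"
      by (simp add: E_def algebra_simps)
    also have "E * norm u \<le> E * (P * N1 y / \<bar>Im c\<bar>)"
      using unorm c E by (intro mult_left_mono) (auto simp: field_simps)
    finally have "(1 - c2) * N1 (B x) \<le> (E * P / \<bar>Im c\<bar> + c2) * N1 y"
      by (simp add: algebra_simps)
    then have "N1 (B x) \<le> (E * P / \<bar>Im c\<bar> + c2) * N1 y / (1 - c2)"
      using c12 by (simp add: pos_le_divide_eq mult.commute)
    then show "N1 (B (\<Gamma>0 u)) \<le> (E * P / \<bar>Im c\<bar> + c2) / (1 - c2) * N1 (\<Gamma>1 u - s *\<^sub>R B (\<Gamma>0 u))"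
      by (simp add: x_def y_def)
  qed
qed

text \<open>The method of continuity on the space \<open>X\<close> of those \<open>u\<close> in the kernel of \<open>T - c\<close> that have \<open>\<Gamma>0 u\<close> in
  \<open>G0\<close>; the solution \<open>k\<close> of the problem with the boundary condition of \<open>A1\<close> takes care of \<open>h\<close>.\<close>

lemma perturbed_boundary_problem_solvable:
  fixes B :: "'g \<Rightarrow> 'g"
  assumes B: "clinear_on G0 B" "\<And>x. x \<in> G0 \<Longrightarrow> B x \<in> G1"
      "\<And>x. x \<in> G0 \<Longrightarrow> cinner (B x) x = cinner x (B x)"
    and c12: "0 \<le> c1" "0 \<le> c2" "c2 < 1"
    and rel: "\<And>x. x \<in> G0 \<Longrightarrow>
      N1 (B x) \<le> c1 * antidual_norm G1 N1 x + c2 * N1 (op_app (weyl_function T \<Gamma>0 \<Gamma>1 \<eta>) x)"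
    and c: "Im c \<noteq> 0" "Range (op_shift A1 c) = UNIV"
  obtains f where "(f, h + c *\<^sub>C f) \<in> T" "\<Gamma>0 f \<in> G0" "\<Gamma>1 f = B (\<Gamma>0 f)"
proof -
  have A1_solve: "\<exists>f. (f, h + c *\<^sub>C f) \<in> A1" for h
    using c(2) by (metis RangeE UNIV_I op_shift_iff)
  have G0I: "\<Gamma>0 f \<in> G0" if "(f, f') \<in> A1" for f f'
    unfolding mem_G0 using that by blast
  obtain C where C: "\<And>s u. 0 \<le> s \<Longrightarrow> s \<le> 1 \<Longrightarrow> (u, c *\<^sub>C u) \<in> T \<Longrightarrow> \<Gamma>0 u \<in> G0 \<Longrightarrow>
      N1 (B (\<Gamma>0 u)) \<le> C * N1 (\<Gamma>1 u - s *\<^sub>R B (\<Gamma>0 u))"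
    using uniform_bound_in_kernel[OF B(2,3) c12 rel c(1)] by blast
  define X where "X = {u. (u, c *\<^sub>C u) \<in> T \<and> \<Gamma>0 u \<in> G0}"
  have XT: "(u, c *\<^sub>C u) \<in> T" and XG: "\<Gamma>0 u \<in> G0" if "u \<in> X" for u
    using that by (auto simp only: X_def)
  have onto: "\<exists>u\<in>X. \<Gamma>1 u - B (\<Gamma>0 u) = y" if y: "y \<in> G1" for y
  proof (rule continuity_method[OF banach_G1 _ _ _ _ _ _ _ y, where a = \<Gamma>1 and b = "\<lambda>u. B (\<Gamma>0 u)"])
    show "complex_vector.subspace X"
    proof (rule complex_vector.subspaceI)
      show "0 \<in> X"
        using linear_operator_zero[OF linear_T] complex_vector.subspace_0[OF subspace_G0]
        by (simp only: X_def mem_Collect_eq \<Gamma>_zero complex_vector.scale_zero_right)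
    next
      fix u v
      assume u: "u \<in> X" and v: "v \<in> X"
      have "(u + v, c *\<^sub>C (u + v)) \<in> T"
        unfolding scaleC_add_right by (rule linear_operator_add[OF linear_T XT[OF u] XT[OF v]])
      moreover have "\<Gamma>0 (u + v) \<in> G0"
        unfolding \<Gamma>_add(1)[OF XT[OF u] XT[OF v]]
        by (rule complex_vector.subspace_add[OF subspace_G0 XG[OF u] XG[OF v]])
      ultimately show "u + v \<in> X"
        by (simp only: X_def mem_Collect_eq)
    next
      fix d u
      assume u: "u \<in> X"
      have "(d *\<^sub>C u, c *\<^sub>C d *\<^sub>C u) \<in> T"
        using linear_operator_scaleC[OF linear_T XT[OF u], of d]
        by (simp add: scaleC_scaleC mult.commute)
      moreover have "\<Gamma>0 (d *\<^sub>C u) \<in> G0"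
        unfolding \<Gamma>_scaleC(1)[OF XT[OF u]]
        by (rule complex_vector.subspace_scale[OF subspace_G0 XG[OF u]])
      ultimately show "d *\<^sub>C u \<in> X"
        by (simp only: X_def mem_Collect_eq)
    qed
    show "clinear_on X \<Gamma>1"
      unfolding clinear_on_def using \<Gamma>_add(2) \<Gamma>_scaleC(2) XT by blast
    show "clinear_on X (\<lambda>u. B (\<Gamma>0 u))"
      unfolding clinear_on_def
    proof (intro conjI allI ballI)
      fix u v d
      assume u: "u \<in> X"
      show "B (\<Gamma>0 (d *\<^sub>C u)) = d *\<^sub>C B (\<Gamma>0 u)"
        unfolding \<Gamma>_scaleC(1)[OF XT[OF u]] using B(1) XG[OF u] by (simp only: clinear_on_def)
      assume v: "v \<in> X"
      show "B (\<Gamma>0 (u + v)) = B (\<Gamma>0 u) + B (\<Gamma>0 v)"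
        unfolding \<Gamma>_add(1)[OF XT[OF u] XT[OF v]] using B(1) XG[OF u] XG[OF v]
        by (simp only: clinear_on_def)
    qed
    show "\<Gamma>1 u \<in> G1" if "u \<in> X" for u
      by (rule \<Gamma>1_in_G1_if_\<Gamma>0_in_G0[OF XT[OF that] XG[OF that]])
    show "B (\<Gamma>0 u) \<in> G1" if "u \<in> X" for u
      by (rule B(2)[OF XG[OF that]])
    show "N1 (B (\<Gamma>0 u)) \<le> C * N1 (\<Gamma>1 u - s *\<^sub>R B (\<Gamma>0 u))" if "0 \<le> s" "s \<le> 1" "u \<in> X" for s u
      by (rule C[OF that(1,2) XT[OF that(3)] XG[OF that(3)]])
    fix z
    assume "z \<in> G1"
    then obtain f f' where f: "(f, f') \<in> T" "\<Gamma>0 f = 0" "\<Gamma>1 f = z"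
      unfolding mem_G1 mem_A0 by blast
    obtain k where k: "(k, (f' - c *\<^sub>C f) + c *\<^sub>C k) \<in> A1"
      using A1_solve by blast
    then have kT: "(k, (f' - c *\<^sub>C f) + c *\<^sub>C k) \<in> T" "\<Gamma>1 k = 0"
      by (simp_all add: mem_A1)
    have "f' - ((f' - c *\<^sub>C f) + c *\<^sub>C k) = c *\<^sub>C (f - k)"
      by (simp add: complex_vector.scale_right_diff_distrib)
    then have "(f - k, c *\<^sub>C (f - k)) \<in> T"
      using linear_operator_diff[OF linear_T f(1) kT(1)] by simp
    moreover have "\<Gamma>0 (f - k) = (-1) *\<^sub>C \<Gamma>0 k"
      using \<Gamma>_diff(1)[OF f(1) kT(1)] f(2) by simp
    then have "\<Gamma>0 (f - k) \<in> G0"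
      using complex_vector.subspace_scale[OF subspace_G0 G0I[OF k], of "-1"] by (simp only:)
    ultimately have "f - k \<in> X"
      by (simp only: X_def mem_Collect_eq)
    moreover have "\<Gamma>1 (f - k) = z"
      using \<Gamma>_diff(2)[OF f(1) kT(1)] kT(2) f(3) by simp
    ultimately show "\<exists>u\<in>X. \<Gamma>1 u = z"
      by blast
  qed
  obtain k where k: "(k, h + c *\<^sub>C k) \<in> A1"
    using A1_solve by blast
  then have kT: "(k, h + c *\<^sub>C k) \<in> T" "\<Gamma>1 k = 0"
    by (simp_all add: mem_A1)
  obtain u where u: "u \<in> X" "\<Gamma>1 u - B (\<Gamma>0 u) = B (\<Gamma>0 k)"
    using onto[OF B(2)[OF G0I[OF k]]] by blast
  show thesis
  proof (rule that)
    show "(k + u, h + c *\<^sub>C (k + u)) \<in> T"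
      using linear_operator_add[OF linear_T kT(1) XT[OF u(1)]] by (simp add: scaleC_add_right add.assoc)
    show "\<Gamma>0 (k + u) \<in> G0"
      unfolding \<Gamma>_add(1)[OF kT(1) XT[OF u(1)]]
      by (rule complex_vector.subspace_add[OF subspace_G0 G0I[OF k] XG[OF u(1)]])
    have "B (\<Gamma>0 k + \<Gamma>0 u) = B (\<Gamma>0 k) + B (\<Gamma>0 u)"
      using B(1) G0I[OF k] XG[OF u(1)] by (simp only: clinear_on_def)
    then show "\<Gamma>1 (k + u) = B (\<Gamma>0 (k + u))"
      unfolding \<Gamma>_add[OF kT(1) XT[OF u(1)]] using kT(2) u(2) by (simp add: algebra_simps)
  qed
qed

lemma symmetric_operator_boundary_condition:
  assumes \<theta>: "symmetric_operator \<theta>"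
  shows "symmetric_operator (op_restrict T {f. (\<Gamma>0 f, \<Gamma>1 f) \<in> \<theta>})"
proof -
  have lin: "linear_operator \<theta>"
    using \<theta> by (simp add: symmetric_operator_def)
  have "linear_operator (op_restrict T {f. (\<Gamma>0 f, \<Gamma>1 f) \<in> \<theta>})"
    using linear_operator_zero[OF lin] linear_operator_add[OF lin] linear_operator_scaleC[OF lin]
    by (intro linear_restrict) (auto simp: \<Gamma>_zero \<Gamma>_add \<Gamma>_scaleC)
  moreover have "cinner f' g = cinner f g'"
    if f: "(f, f') \<in> T" "(\<Gamma>0 f, \<Gamma>1 f) \<in> \<theta>" and g: "(g, g') \<in> T" "(\<Gamma>0 g, \<Gamma>1 g) \<in> \<theta>" for f f' g g'
  proof -
    have "cinner (\<Gamma>1 f) (\<Gamma>0 g) = cinner (\<Gamma>0 f) (\<Gamma>1 g)"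
      using \<theta> f(2) g(2) unfolding symmetric_operator_def by blast
    then show ?thesis
      using green[OF f(1) g(1)] by simp
  qed
  ultimately show ?thesis
    unfolding symmetric_operator_def by (auto simp: op_restrict_def)
qed

text \<open>Here \<open>Domain \<theta>\<close> may be larger than \<open>G0\<close>, but the solutions with \<open>\<Gamma>0 f\<close> in \<open>G0\<close> already exhaust
  the range, so that symmetry alone controls the rest of the domain.\<close>

lemma self_adjoint_boundary_condition:
  assumes \<eta>1: "\<eta> \<in> resolvent_set A1"
    and \<theta>: "symmetric_operator \<theta>" "G0 \<subseteq> Domain \<theta>" "\<And>x. x \<in> G0 \<Longrightarrow> op_app \<theta> x \<in> G1"
    and c12: "0 \<le> c1" "0 \<le> c2" "c2 < 1"
    and rel: "\<And>x. x \<in> G0 \<Longrightarrow> N1 (op_app \<theta> x)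
      \<le> c1 * antidual_norm G1 N1 x + c2 * N1 (op_app (weyl_function T \<Gamma>0 \<Gamma>1 \<eta>) x)"
  shows "self_adjoint (op_restrict T {f. (\<Gamma>0 f, \<Gamma>1 f) \<in> \<theta>})"
proof -
  have lin: "linear_operator \<theta>"
    using \<theta>(1) by (simp add: symmetric_operator_def)
  have mem: "(x, op_app \<theta> x) \<in> \<theta>" if "x \<in> G0" for x
    by (rule op_app_mem[OF lin]) (use that \<theta>(2) in blast)
  have sym: "cinner (op_app \<theta> x) x = cinner x (op_app \<theta> x)" if "x \<in> G0" for x
    using \<theta>(1) mem[OF that] unfolding symmetric_operator_def by blast
  obtain e where e: "e > 0" "\<And>d. cmod (d - \<eta>) < e \<Longrightarrow> Range (op_shift A1 d) = UNIV"
    using range_shift_near_resolvent_set[OF linear_A1 \<eta>1] by blast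
  have range: "Range (op_shift (op_restrict T {f. (\<Gamma>0 f, \<Gamma>1 f) \<in> \<theta>}) d) = UNIV"
    if d: "Im d \<noteq> 0" "cmod (d - \<eta>) < e" for d
  proof -
    have "h \<in> Range (op_shift (op_restrict T {f. (\<Gamma>0 f, \<Gamma>1 f) \<in> \<theta>}) d)" for h
    proof -
      obtain f where f: "(f, h + d *\<^sub>C f) \<in> T" "\<Gamma>0 f \<in> G0" "\<Gamma>1 f = op_app \<theta> (\<Gamma>0 f)"
        using perturbed_boundary_problem_solvable[OF clinear_on_op_app[OF lin \<theta>(2)] \<theta>(3) sym c12 rel
            d(1) e(2)[OF d(2)]] .
      then have "(f, h + d *\<^sub>C f) \<in> op_restrict T {f. (\<Gamma>0 f, \<Gamma>1 f) \<in> \<theta>}"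
        using mem[OF f(2)] by (simp add: op_restrict_def)
      then show ?thesis
        unfolding op_shift_iff[symmetric] by blast
    qed
    then show ?thesis
      by blast
  qed
  (* Non-real, and so close to \<eta> that both A1 - c and A1 - cnj c are onto. *)
  define c where "c = \<eta> + \<i> * complex_of_real (e / 2)"
  have "Im \<eta> = 0"
    using \<eta>(2) by (simp add: complex_is_Real_iff)
  moreover have "cnj \<eta> = \<eta>"
    using \<eta>(2) by (simp add: Reals_cnj_iff)
  ultimately have "Im c \<noteq> 0" "cmod (c - \<eta>) < e" "cmod (cnj c - \<eta>) < e"
    using e(1) by (simp_all add: c_def norm_mult norm_divide)
  then show ?thesis
    using self_adjoint_if_ranges[OF symmetric_operator_boundary_condition[OF \<theta>(1)], of c]
      range[of c] range[of "cnj c"] by simp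
qed

end

section \<open>Self-adjointness under the three conditions\<close>

theorem proposition3p10:
  fixes A T A0 A1 :: "('h::complex_hilbert \<times> 'h) set"
    and \<Gamma>0 \<Gamma>1 :: "'h \<Rightarrow> 'g::complex_hilbert"
    and G0 G1 :: "'g set"
    and N0 N1 :: "'g \<Rightarrow> real"
    and M :: "complex \<Rightarrow> ('g \<times> 'g) set"
    and \<theta> :: "('g \<times> 'g) set"
    and \<eta> :: complex
  assumes separable: "separable_space (euclidean :: 'h topology)"
    and A: "closed A" "densely_defined A" "symmetric_operator A"
    and triple: "quasi_boundary_triple A T \<Gamma>0 \<Gamma>1"
    and A0_eq: "A0 = op_restrict T {f. \<Gamma>0 f = 0}"
    and A1_eq: "A1 = op_restrict T {f. \<Gamma>1 f = 0}"
    and M_eq: "M = weyl_function T \<Gamma>0 \<Gamma>1"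
    and A1: "self_adjoint A1"
    and \<eta>: "\<eta> \<in> resolvent_set A0 \<inter> resolvent_set A1 \<inter> \<real>"
    and G0_eq: "G0 = \<Gamma>0 ` {f \<in> Domain T. \<Gamma>1 f = 0}"
    and G1_eq: "G1 = \<Gamma>1 ` {f \<in> Domain T. \<Gamma>0 f = 0}"
    and dense: "closure G0 = UNIV" "closure G1 = UNIV"
    and N0: "reflexive_banach_embedded G0 N0"
    and N1: "reflexive_banach_embedded G1 N1"
    and cont0: "\<exists>l\<in>resolvent_set A1.
      bounded_op norm N0 ((op_shift A1 (cnj l))\<inverse> O graph_on (Domain T) \<Gamma>0)"
    and cont1: "\<exists>l\<in>resolvent_set A0.
      bounded_op norm N1 ((op_shift A0 (cnj l))\<inverse> O graph_on (Domain T) \<Gamma>1)"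
    and \<theta>: "symmetric_operator \<theta>" "G0 \<subseteq> Domain \<theta>" "Range (op_restrict \<theta> G0) \<subseteq> G1"
    and i_or_ii_or_iii:
      "compact_operator G0 N0 G1 N1 (op_restrict \<theta> G0) \<or>
       relatively_compact (antidual_norm G1 N1) G1 N1 (op_restrict \<theta> G0) (op_restrict (M \<eta>) G0) \<or>
       (\<exists>c1 c2. c1 > 0 \<and> 0 \<le> c2 \<and> c2 < 1 \<and>
          (\<forall>x\<in>G0. N1 (op_app \<theta> x) \<le> c1 * antidual_norm G1 N1 x + c2 * N1 (op_app (M \<eta>) x)))"
  shows "self_adjoint (op_restrict T {f. (\<Gamma>0 f, \<Gamma>1 f) \<in> \<theta>})"
proof -
  have \<eta>': "\<eta> \<in> resolvent_set A0" "\<eta> \<in> resolvent_set A1" "\<eta> \<in> \<real>"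
    using \<eta> by simp_all
  have T: "linear_operator T" "clinear_on (Domain T) \<Gamma>0" "clinear_on (Domain T) \<Gamma>1"
    and green: "\<forall>(f, Tf) \<in> T. \<forall>(g, Tg) \<in> T.
      cinner Tf g - cinner f Tg = cinner (\<Gamma>1 f) (\<Gamma>0 g) - cinner (\<Gamma>0 f) (\<Gamma>1 g)"
    using triple by (simp_all add: quasi_boundary_triple_def)
  interpret boundary_maps T \<Gamma>0 \<Gamma>1
    by standard (use T green in blast)+
  interpret regularized_boundary_maps T \<Gamma>0 \<Gamma>1 \<eta> N1
    by standard (use \<eta>' cont1 N1 in \<open>simp_all add: A0_eq G1_eq reflexive_banach_embedded_def\<close>)
  have n0: "normed_on G0 N0"
    by (rule normed_on_if_embedded[OF N0])
  have n1: "normed_on G1 N1"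
    by (rule normed_on_if_embedded[OF N1])
  have sub: "complex_vector.subspace G0"
    using subspace_G0 by (simp only: G0_eq)
  have lin: "linear_operator \<theta>"
    using \<theta>(1) by (simp add: symmetric_operator_def)
  have mem: "(x, op_app \<theta> x) \<in> \<theta>" if "x \<in> G0" for x
    by (rule op_app_mem[OF lin]) (use that \<theta>(2) in blast)
  have \<theta>G1: "op_app \<theta> x \<in> G1" if "x \<in> G0" for x
    using mem[OF that] that \<theta>(3) by (auto simp: op_restrict_def)
  have sym: "cinner (op_app \<theta> x) y = cinner x (op_app \<theta> y)" if "x \<in> G0" "y \<in> G0" for x y
    using \<theta>(1) mem[OF that(1)] mem[OF that(2)] unfolding symmetric_operator_def by blast
  note clin = clinear_on_op_app[OF lin \<theta>(2)]
  have M: "\<exists>g. (g, \<eta> *\<^sub>C g) \<in> T \<and> \<Gamma>0 g = x \<and> \<Gamma>1 g = op_app (M \<eta>) x \<and> op_app (M \<eta>) x \<in> G1"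
    if "x \<in> G0" for x
  proof -
    from that obtain g where "(g, \<eta> *\<^sub>C g) \<in> T" "\<Gamma>0 g = x" "\<Gamma>1 g \<in> G1"
      unfolding G0_eq G1_eq by (rule G0_obtain)
    then show ?thesis
      using op_app_weyl[of g] by (auto simp: M_eq)
  qed
  have M_scale: "op_app (M \<eta>) (t *\<^sub>R x) = t *\<^sub>R op_app (M \<eta>) x" if "x \<in> G0" for t x
  proof -
    obtain g where g: "(g, \<eta> *\<^sub>C g) \<in> T" "\<Gamma>0 g = x" "\<Gamma>1 g = op_app (M \<eta>) x"
      using M[OF \<open>x \<in> G0\<close>] by blast
    have "(complex_of_real t *\<^sub>C g, \<eta> *\<^sub>C complex_of_real t *\<^sub>C g) \<in> T"
      using linear_operator_scaleC[OF T(1) g(1), of "complex_of_real t"]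
      by (simp add: scaleC_scaleC mult.commute)
    from op_app_weyl[OF this] show ?thesis
      using \<Gamma>_scaleC[OF g(1), of "complex_of_real t"] g(2,3) by (simp add: M_eq scaleR_scaleC)
  qed
  have "\<exists>c1 c2. c1 > 0 \<and> 0 \<le> c2 \<and> c2 < 1 \<and>
      (\<forall>x\<in>G0. N1 (op_app \<theta> x) \<le> c1 * antidual_norm G1 N1 x + c2 * N1 (op_app (M \<eta>) x))"
    using i_or_ii_or_iii
  proof (elim disjE)
    assume comp: "compact_operator G0 N0 G1 N1 (op_restrict \<theta> G0)"
    obtain C where C: "C > 0" "\<And>x. x \<in> G0 \<Longrightarrow> N0 x \<le> C * N1 (op_app (M \<eta>) x)"
      using weyl_inverse_bound[of N0] \<eta>'(2) cont0 unfolding A1_eq G0_eq M_eq by blast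
    (* With this factor, N0 turns into half of the norm of M \<eta> x. *)
    have "\<exists>c>0. \<forall>x\<in>G0. N1 (op_app \<theta> x) \<le> c * antidual_norm G1 N1 x + 1 / (2 * C) * N0 x"
    proof (rule small_relative_bound_if_compact[OF N1 sub dense(1) clin \<theta>G1 sym, of N0 "1 / (2 * C)"])
      show "N0 x \<ge> 0" if "x \<in> G0" for x
        by (rule normed_on_nonneg[OF n0 that])
      show "N0 (t *\<^sub>R x) = \<bar>t\<bar> * N0 x" if "x \<in> G0" for t x
        by (rule normed_on_norm_scaleR[OF n0 that])
      show "1 / (2 * C) > 0"
        using C(1) by simp
      fix x :: "nat \<Rightarrow> 'g"
      assume x: "range x \<subseteq> G0" "\<exists>K. \<forall>n. antidual_norm G1 N1 (x n) + N0 (x n) \<le> K"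
      then obtain K where "\<And>n. antidual_norm G1 N1 (x n) + N0 (x n) \<le> K"
        by blast
      then have "N0 (x n) \<le> K" for n
        using antidual_norm_nonneg[OF N1, of "x n"] by (smt (verit))
      then obtain r :: "nat \<Rightarrow> nat"
        where "strict_mono r" "converges_in G1 N1 (\<lambda>n. op_app (op_restrict \<theta> G0) (x (r n)))"
        using comp x(1) unfolding compact_operator_def by blast
      moreover have "op_app (op_restrict \<theta> G0) (x (r n)) = op_app \<theta> (x (r n))" for n
        using x(1) by (intro op_app_restrict) auto
      ultimately show "\<exists>r :: nat \<Rightarrow> nat. strict_mono r \<and> converges_in G1 N1 (\<lambda>n. op_app \<theta> (x (r n)))"
        by auto
    qed
    then obtain c where c: "c > 0" "\<And>x. x \<in> G0 \<Longrightarrow>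
        N1 (op_app \<theta> x) \<le> c * antidual_norm G1 N1 x + 1 / (2 * C) * N0 x"
      by blast
    have "1 / (2 * C) * N0 x \<le> 1/2 * N1 (op_app (M \<eta>) x)" if "x \<in> G0" for x
      using C(1) C(2)[OF that] by (simp add: field_simps)
    then have "\<forall>x\<in>G0. N1 (op_app \<theta> x) \<le> c * antidual_norm G1 N1 x + 1/2 * N1 (op_app (M \<eta>) x)"
      using c(2) by fastforce
    then show ?thesis
      using c(1) by (intro exI[of _ c] exI[of _ "1/2"]) simp
  next
    assume comp: "relatively_compact (antidual_norm G1 N1) G1 N1 (op_restrict \<theta> G0) (op_restrict (M \<eta>) G0)"
    have "\<exists>c>0. \<forall>x\<in>G0. N1 (op_app \<theta> x) \<le> c * antidual_norm G1 N1 x + 1/2 * N1 (op_app (M \<eta>) x)"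
    proof (rule small_relative_bound_if_compact[OF N1 sub dense(1) clin \<theta>G1 sym,
          of "\<lambda>x. N1 (op_app (M \<eta>) x)" "1/2"])
      show "N1 (op_app (M \<eta>) x) \<ge> 0" if "x \<in> G0" for x
        using M[OF that] normed_on_nonneg[OF n1] by blast
      show "N1 (op_app (M \<eta>) (t *\<^sub>R x)) = \<bar>t\<bar> * N1 (op_app (M \<eta>) x)" if "x \<in> G0" for t x
        unfolding M_scale[OF that] using M[OF that] normed_on_norm_scaleR[OF n1] by blast
      show "(1/2::real) > 0"
        by simp
      fix x :: "nat \<Rightarrow> 'g"
      assume x: "range x \<subseteq> G0" "\<exists>K. \<forall>n. antidual_norm G1 N1 (x n) + N1 (op_app (M \<eta>) (x n)) \<le> K"
      have "G0 \<subseteq> Domain (op_restrict (M \<eta>) G0)"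
        using M unfolding op_restrict_def M_eq weyl_iff by fastforce
      then have "range x \<subseteq> Domain (op_restrict (M \<eta>) G0)"
        using x(1) by blast
      moreover have app: "op_app (op_restrict S G0) (x n) = op_app S (x n)" for S :: "('g \<times> 'g) set" and n
        using x(1) by (intro op_app_restrict) auto
      then have "\<exists>K. \<forall>n. antidual_norm G1 N1 (x n) + N1 (op_app (op_restrict (M \<eta>) G0) (x n)) \<le> K"
        using x(2) by simp
      ultimately have "\<exists>r :: nat \<Rightarrow> nat. strict_mono r \<and>
          converges_in G1 N1 (\<lambda>n. op_app (op_restrict \<theta> G0) (x (r n)))"
        using comp unfolding relatively_compact_def by blast
      then show "\<exists>r :: nat \<Rightarrow> nat. strict_mono r \<and> converges_in G1 N1 (\<lambda>n. op_app \<theta> (x (r n)))"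
        by (simp add: app)
    qed
    then obtain c where "c > 0"
      "\<And>x. x \<in> G0 \<Longrightarrow> N1 (op_app \<theta> x) \<le> c * antidual_norm G1 N1 x + 1/2 * N1 (op_app (M \<eta>) x)"
      by blast
    then show ?thesis
      by (intro exI[of _ c] exI[of _ "1/2"]) simp
  qed
  then obtain c1 c2 where "c1 > 0" "0 \<le> c2" "c2 < 1"
    "\<And>x. x \<in> G0 \<Longrightarrow> N1 (op_app \<theta> x) \<le> c1 * antidual_norm G1 N1 x + c2 * N1 (op_app (M \<eta>) x)"
    by blast
  then show ?thesis
    using \<eta>'(2) \<theta>(1,2) \<theta>G1
    by (intro self_adjoint_boundary_condition[where ?c1.0 = c1 and ?c2.0 = c2])
      (simp_all add: A1_eq G0_eq G1_eq M_eq)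
qed

end
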